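(* Let $q$ be a fixed prime power and $n\to\infty$. Let $\mu_0,\mu_1,\dots$ be a sequence of probability measures on $\mathbb{F}_q$, with $\overline{\mu}=(\mu_0,\dots,\mu_{n-1})$. Suppose there exists a constant $c_{\overline{\mu}}$ bounded away from $1$ such that the maximum non-trivial Fourier amplitude satisfies \[\max_i\max_{\alpha\in\mathbb{F}_q^\times}|\hat\mu_i(\alpha)|\le c_{\overline{\mu}}.\] Then the probability that a random monic polynomial $f(t)=t^n+\sum_{i=0}^{n-1}\varepsilon_it^i$, with each coefficient $\varepsilon_i$ drawn independently according to $\mu_i$, is squarefree is given by \[\mathbb{P}_{\overline{\mu}}(f\text{ is squarefree})=\kappa_{\overline{\mu}}+O_q\bigl(q^{-n^{1/4}}\bigr),\] where the asymptotic density $\kappa_{\overline{\mu}}$ is \[\kappa_{\overline{\mu}}=\frac{1}{1+1/q}\bigl(1-\mu_0(0)\mu_1(0)\bigr)=c_0(1-\Lambda),\qquad c_0=\frac1{1+1/q},\quad \Lambda=\mu_0(0)\mu_1(0).\]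
   Context: $q$ is a power of the prime $p$, and $\mathrm{tr}:\mathbb{F}_q\to\mathbb{F}_p$ is the trace map. For a probability measure $\mu$ on $\mathbb{F}_q$ the discrete Fourier transform is $\hat\mu(\alpha)=\sum_{\xi\in\mathbb{F}_q}\mu(\xi)\exp\bigl(\frac{2\pi i\,\mathrm{tr}(-\alpha\xi)}{p}\bigr)$. The notation $O_q$ means that the implied constant may depend on $q$. The number $\Lambda$ is the probability that $t^2\mid f$. *)

theory Defs
  imports
    "HOL-Probability.Probability"
    "HOL-Probability.Product_PMF"
    "HOL-Computational_Algebra.Computational_Algebra"
begin

text \<open>
  The type \<open>'a :: finite_field\<close> plays the role of the field with \<open>q = CARD('a)\<close> elements;
  its characteristic is \<open>p = CHAR('a)\<close>.
\<close>

definition ext_degree :: "'a::finite_field itself \<Rightarrow> nat" where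
  "ext_degree _ = (THE k. CARD('a) = CHAR('a) ^ k)"

text \<open>The trace to the prime field, as the sum of the Frobenius conjugates of \<open>x\<close>.\<close>

definition trace_Fp :: "'a::finite_field \<Rightarrow> 'a" where
  "trace_Fp x = (\<Sum>j<ext_degree TYPE('a). x ^ (CHAR('a) ^ j))"

text \<open>
  The trace takes values in the prime field, realised inside \<open>'a\<close> as the image of \<open>of_nat\<close>.
  To divide by \<open>p\<close> in the exponential we pick its representative in \<open>{0..<p}\<close>.
\<close>

definition tr :: "'a::finite_field \<Rightarrow> nat" where
  "tr x = (LEAST m. of_nat m = trace_Fp x)"

definition fourier :: "'a::finite_field pmf \<Rightarrow> 'a \<Rightarrow> complex" where
  "fourier \<mu> \<alpha> = (\<Sum>\<xi>\<in>UNIV. complex_of_real (pmf \<mu> \<xi>) *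
      exp (2 * complex_of_real pi * \<i> * of_nat (tr (- \<alpha> * \<xi>)) / of_nat CHAR('a)))"

text \<open>
  \<open>Pi_pmf {..<n} 0 \<mu>\<close> is the joint law of independent coefficients \<open>\<epsilon> i \<sim> \<mu> i\<close>, \<open>i < n\<close>.
\<close>

definition random_monic_poly :: "(nat \<Rightarrow> 'a::finite_field pmf) \<Rightarrow> nat \<Rightarrow> 'a poly pmf" where
  "random_monic_poly \<mu> n =
     map_pmf (\<lambda>\<epsilon>. monom 1 n + (\<Sum>i<n. monom (\<epsilon> i) i)) (Pi_pmf {..<n} 0 \<mu>)"

definition prob_squarefree :: "(nat \<Rightarrow> 'a::finite_field pmf) \<Rightarrow> nat \<Rightarrow> real" where
  "prob_squarefree \<mu> n = measure_pmf.prob (random_monic_poly \<mu> n) {f. squarefree f}"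

definition Lambda :: "(nat \<Rightarrow> 'a::finite_field pmf) \<Rightarrow> nat \<Rightarrow> real" where
  "Lambda \<mu> n = measure_pmf.prob (random_monic_poly \<mu> n) {f. (monom 1 1)\<^sup>2 dvd f}"

definition c0 :: "'a::finite_field itself \<Rightarrow> real" where
  "c0 _ = 1 / (1 + 1 / real CARD('a))"

definition kappa :: "(nat \<Rightarrow> 'a::finite_field pmf) \<Rightarrow> real" where
  "kappa \<mu> = 1 / (1 + 1 / real CARD('a)) * (1 - pmf (\<mu> 0) 0 * pmf (\<mu> 1) 0)"

end

theory Submission
  imports Defs "HOL-Number_Theory.Cong" "HOL-Real_Asymp.Real_Asymp"
begin

text \<open>
  A monic \<open>f\<close> fails to be squarefree if \<open>t ^ 2\<close> divides it, which concerns only its two lowest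
  coefficients, or if \<open>P ^ 2\<close> divides it for another prime \<open>P\<close>. Among uniformly distributed
  polynomials the second event has density \<open>1 - q / (q + 1)\<close>. The proof shows that it keeps this
  probability, up to a small error, under every law of the coefficients for which the Fourier bound
  holds from the coefficient of \<open>t ^ 2\<close> on. This class of laws allows conditioning on the vanishing
  of the two lowest coefficients (\<open>prob_Pi_pmf_two_zero\<close>). So the two events are nearly
  independent, whence the factor \<open>1 - \<mu> 0 0 * \<mu> 1 0\<close>.

  The primes \<open>P \<noteq> t\<close> are split at degree \<open>D\<close>, about \<open>n powr 0.3\<close>.

  \<^item> Large primes (\<open>prob_large_square_le\<close>). If \<open>P ^ 2\<close> divides \<open>f\<close>, then \<open>P\<close> divides \<open>f\<close> and its
    derivative. The coefficients of the powers of \<open>t ^ p\<close> do not enter the derivative. So one can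
    first reveal the derivative, which has at most \<open>n\<close> prime divisors, and then use the fresh
    randomness of \<open>D\<close> further coefficients to bound the chance that \<open>P\<close> divides \<open>f\<close> by
    \<open>\<rho> ^ D\<close>, where \<open>\<rho> < 1\<close> bounds the atoms of the coefficients.

  \<^item> Small primes (\<open>prob_no_square_below_approx\<close>). The absence of squares of small primes is
    expressed by a Moebius sum over the squares \<open>m ^ 2\<close> dividing \<open>f\<close>, truncated at degree \<open>2 * D\<close>
    for \<open>m\<close>. The truncation error is again a sum over squares dividing \<open>f\<close>
    (\<open>truncated_sieve_error\<close>), so all that is needed is the probability that a fixed \<open>H\<close> with
    nonzero constant term divides \<open>f\<close>. An expansion into additive characters gives
    \<open>1 / q ^ degree H\<close> with an error of at most \<open>c ^ ((n - 2) div degree H)\<close>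
    (\<open>prob_dvd_monic_poly_approx\<close>): a nontrivial functional on the residues modulo \<open>H\<close> cannot
    vanish on \<open>degree H\<close> consecutive powers of \<open>t\<close>, as \<open>t\<close> is a unit modulo \<open>H\<close>. Since the degree of
    \<open>H\<close> is at most \<open>4 * D\<close>, the error is exponentially small in \<open>n powr 0.7\<close>, enough to outweigh the number
    of terms, which is exponential in \<open>D\<close>.

  The main term is a partial sum of the Dirichlet series of the Moebius function restricted to
  polynomials prime to \<open>t\<close>, evaluated by \<open>sum_mob_monics\<close>.
\<close>


section \<open>The standard additive character of a finite field\<close>

text \<open>
  Among the additive subgroups whose order is a power of the characteristic \<open>p\<close>, one of maximal
  order is the whole field, since adjoining the multiples of a missing element multiplies the
  order by \<open>p\<close>.
\<close>

lemma card_finite_field_eq_CHAR_power: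
  "\<exists>k. CARD('a::finite_field) = CHAR('a) ^ k"
proof -
  define p where "p = CHAR('a)"
  have p: "prime p" "p > 0" "(of_nat p :: 'a) = 0" by (auto simp: p_def)
  define \<S> where "\<S> = {S :: 'a set. 0 \<in> S \<and> (\<forall>x\<in>S. \<forall>y\<in>S. x + y \<in> S) \<and> (\<exists>k. card S = p ^ k)}"
  have "{0} \<in> \<S>" by (auto simp: \<S>_def intro: exI[of _ 0])
  have fin: "finite \<S>" by simp
  with \<open>{0} \<in> \<S>\<close> have "Max (card ` \<S>) \<in> card ` \<S>" by (intro Max_in) auto
  then obtain S where S: "S \<in> \<S>" and S': "Max (card ` \<S>) = card S" by auto
  have max: "card T \<le> card S" if "T \<in> \<S>" for T
    unfolding S'[symmetric] using fin that by (intro Max_ge) auto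
  from S have S0: "0 \<in> S" and Sadd: "\<And>x y. x \<in> S \<Longrightarrow> y \<in> S \<Longrightarrow> x + y \<in> S"
    by (auto simp: \<S>_def)
  obtain k where k: "card S = p ^ k" using S by (auto simp: \<S>_def)
  have Smult: "of_nat m * x \<in> S" if "x \<in> S" for m x
    by (induction m) (auto simp: S0 Sadd that algebra_simps)
  have Sdiff: "x - y \<in> S" if "x \<in> S" "y \<in> S" for x y
  proof -
    have "of_nat (p - 1) * y = - y"
      using p by (simp add: of_nat_diff Suc_leI algebra_simps)
    then show ?thesis using Sadd[OF that(1) Smult[OF that(2), of "p - 1"]] by simp
  qed
  have "S = UNIV"
  proof (rule ccontr)
    assume "S \<noteq> UNIV"
    then obtain x where x: "x \<notin> S" by auto
    have index_unique: "i = j" if "i < p" "j < p" "of_nat i * x - of_nat j * x \<in> S" for i j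
    proof (rule ccontr)
      have *: False if "j < i" "i < p" "of_nat i * x - of_nat j * x \<in> S" for i j
      proof -
        have "coprime (i - j) p"
          using that p by (metis coprime_commute diff_le_self le_less_trans
              nat_dvd_not_less prime_imp_coprime zero_less_diff)
        then obtain u where u: "[(i - j) * u = 1] (mod p)"
          using cong_solve_coprime_nat by auto
        then have "(of_nat ((i - j) * u) :: 'a) = of_nat 1"
          by (subst of_nat_eq_iff_cong_CHAR) (simp add: p_def)
        moreover have "of_nat u * (of_nat i * x - of_nat j * x) = of_nat ((i - j) * u) * x"
          using that by (simp add: of_nat_diff algebra_simps)
        ultimately show False using Smult[OF that(3), of u] x by simp
      qed
      assume "i \<noteq> j"
      then consider "j < i" | "i < j" by linarith
      then show False
      proof cases
        case 1 then show ?thesis using * that by blast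
      next
        case 2
        have "of_nat j * x - of_nat i * x \<in> S"
          using Sdiff[OF S0 that(3)] by simp
        then show ?thesis using * 2 that by blast
      qed
    qed
    define T where "T = (\<lambda>(s, i). s + of_nat i * x) ` (S \<times> {..<p})"
    have "inj_on (\<lambda>(s, i). s + of_nat i * x) (S \<times> {..<p})"
    proof (rule inj_onI, clarsimp)
      fix s i s' j assume a: "s \<in> S" "i < p" "s' \<in> S" "j < p" "s + of_nat i * x = s' + of_nat j * x"
      then have "of_nat i * x - of_nat j * x = s' - s" by (simp add: algebra_simps)
      then have "i = j" using index_unique a Sdiff by metis
      then show "s = s' \<and> i = j" using a by simp
    qed
    then have cT: "card T = p ^ Suc k" by (simp add: T_def card_image k)
    have "T \<in> \<S>"
    proof -
      have T0: "0 \<in> T" unfolding T_def using S0 p by (intro image_eqI[of _ _ "(0,0)"]) auto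
      have Tadd: "a + b \<in> T" if "a \<in> T" "b \<in> T" for a b
      proof -
        from that obtain s i s' j where *: "s \<in> S" "s' \<in> S" "i < p" "j < p"
          "a = s + of_nat i * x" "b = s' + of_nat j * x" by (auto simp: T_def)
        have "(of_nat (i + j) :: 'a) = of_nat ((i + j) mod p)"
          by (subst of_nat_eq_iff_cong_CHAR) (simp add: p_def)
        then have "a + b = (s + s') + of_nat ((i + j) mod p) * x"
          using * by (simp add: algebra_simps flip: of_nat_add distrib_left distrib_right)
        then show ?thesis unfolding T_def using * p Sadd
          by (intro image_eqI[of _ _ "(s + s', (i + j) mod p)"]) auto
      qed
      show ?thesis unfolding \<S>_def mem_Collect_eq
      proof (intro conjI)
        show "\<forall>x\<in>T. \<forall>y\<in>T. x + y \<in> T" using Tadd by blast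
        show "\<exists>k. card T = p ^ k" using cT by (rule exI)
      qed (rule T0)
    qed
    from max[OF this] cT k p have "p ^ Suc k \<le> p ^ k" by (simp only:)
    moreover have "p ^ k < p ^ Suc k"
      using prime_gt_1_nat[OF p(1)] by (rule power_strict_increasing[OF lessI])
    ultimately show False by linarith
  qed
  then show ?thesis using k p_def by auto
qed

lemma card_eq_CHAR_power_ext_degree:
  "CARD('a::finite_field) = CHAR('a) ^ ext_degree TYPE('a)"
proof -
  obtain k where k: "CARD('a) = CHAR('a) ^ k"
    using card_finite_field_eq_CHAR_power by blast
  have "CHAR('a) > 1" by (rule prime_gt_1_nat) (rule CHAR_prime)
  then have "ext_degree TYPE('a) = k"
    unfolding ext_degree_def using k by (intro the_equality) (auto simp: power_inject_exp)
  with k show ?thesis by simp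
qed

text \<open>The polynomial \<open>X ^ p - X\<close> has no more roots than the \<open>p\<close> elements of the prime field.\<close>

lemma frobenius_fixed_imp_of_nat:
  fixes x :: "'a::finite_field"
  assumes "x ^ CHAR('a) = x"
  shows   "\<exists>m. of_nat m = x"
proof -
  define p where "p = CHAR('a)"
  have p: "prime p" "p > 1" "p > 0" by (auto simp: p_def prime_gt_Suc_0_nat prime_gt_0_nat)
  define P where "P = monom 1 p - monom (1::'a) 1"
  have cP: "coeff P p = 1" using p by (simp add: P_def)
  then have "P \<noteq> 0" by auto
  have "degree P \<le> p" unfolding P_def using p
    by (intro degree_diff_le) (auto simp: degree_monom_eq)
  have roots: "{x. poly P x = 0} = {x. x ^ p = x}" by (auto simp: P_def poly_monom)
  have of_nat_p: "(of_nat m :: 'a) ^ p = of_nat m" for m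
  proof (induction m)
    case (Suc m)
    then show ?case using freshmans_dream[of p "1::'a" "of_nat m"] p by (simp add: p_def)
  qed (use p in auto)
  have "inj_on (of_nat :: nat \<Rightarrow> 'a) {..<p}"
    by (rule inj_onI) (auto simp: of_nat_eq_iff_cong_CHAR cong_def p_def)
  then have c: "card ((of_nat :: nat \<Rightarrow> 'a) ` {..<p}) = p" by (simp add: card_image)
  have "(of_nat :: nat \<Rightarrow> 'a) ` {..<p} = {x. x ^ p = x}"
  proof (rule card_seteq)
    show "card {x::'a. x ^ p = x} \<le> card ((of_nat :: nat \<Rightarrow> 'a) ` {..<p})"
      using card_poly_roots_bound[OF \<open>P \<noteq> 0\<close>] roots \<open>degree P \<le> p\<close> c by simp
  qed (auto simp: of_nat_p)
  with assms show ?thesis unfolding p_def by (metis (mono_tags, lifting) imageE mem_Collect_eq)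
qed

lemma trace_Fp_add: "trace_Fp (x + y :: 'a::finite_field) = trace_Fp x + trace_Fp y"
  by (simp add: trace_Fp_def freshmans_dream' sum.distrib)

text \<open>Frobenius permutes the summands of the trace cyclically, as \<open>x ^ q = x\<close>.\<close>

lemma of_nat_tr: "of_nat (tr x) = trace_Fp (x :: 'a::finite_field)"
proof -
  define k where "k = ext_degree TYPE('a)"
  have "trace_Fp x ^ CHAR('a) = (\<Sum>j<k. x ^ (CHAR('a) ^ Suc j))"
    unfolding trace_Fp_def k_def
    by (subst freshmans_dream_sum) (simp_all add: mult.commute flip: power_mult)
  also have "\<dots> + x ^ (CHAR('a) ^ 0) = (\<Sum>j<Suc k. x ^ (CHAR('a) ^ j))"
    by (subst sum.lessThan_Suc_shift) simp
  also have "\<dots> = trace_Fp x + x ^ CARD('a)"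
    by (simp add: trace_Fp_def k_def card_eq_CHAR_power_ext_degree[symmetric])
  finally have "trace_Fp x ^ CHAR('a) = trace_Fp x"
    by (simp add: finite_field_power_card_eq_same)
  from frobenius_fixed_imp_of_nat[OF this] show ?thesis
    unfolding tr_def by (rule LeastI_ex)
qed

text \<open>
  Since \<open>tr\<close> lifts the trace to \<open>{0..<p}\<close>, it is additive only modulo \<open>p\<close>; the exponential does not
  notice the difference.
\<close>

definition add_char :: "'a::finite_field \<Rightarrow> complex" where
  "add_char x = exp (2 * complex_of_real pi * \<i> * of_nat (tr x) / of_nat CHAR('a))"

lemma add_char_add: "add_char (x + y :: 'a::finite_field) = add_char x * add_char y"
proof -
  let ?p = "CHAR('a)"
  have p: "?p > 0" by simp
  have "of_nat (tr (x + y)) = (of_nat (tr x + tr y) :: 'a)"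
    by (simp add: of_nat_tr trace_Fp_add)
  then have "[tr (x + y) = tr x + tr y] (mod ?p)" by (simp only: of_nat_eq_iff_cong_CHAR)
  then obtain k where "int (tr (x + y)) = int (tr x + tr y) + int ?p * k"
    by (metis cong_int_iff cong_iff_lin cong_sym)
  then have "(of_int (int (tr (x + y))) :: complex) = of_int (int (tr x + tr y) + int ?p * k)"
    by simp
  then have "2 * complex_of_real pi * \<i> * of_nat (tr (x + y)) / of_nat ?p =
     2 * complex_of_real pi * \<i> * of_nat (tr x) / of_nat ?p +
     2 * complex_of_real pi * \<i> * of_nat (tr y) / of_nat ?p + of_int k * (2 * complex_of_real pi * \<i>)"
    using p by (simp add: field_simps)
  then show ?thesis unfolding add_char_def
    by (simp add: exp_add exp_integer_2pi mult_ac)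
qed

lemma norm_add_char [simp]: "norm (add_char x) = 1"
proof -
  have "add_char x = cis (2 * pi * real (tr x) / real CHAR('a))"
    unfolding add_char_def cis_conv_exp by (simp add: mult_ac)
  then show ?thesis by simp
qed

lemma add_char_nonzero [simp]: "add_char x \<noteq> 0"
  by (simp add: add_char_def)

lemma add_char_0 [simp]: "add_char 0 = 1"
  using add_char_add[of 0 0] by simp

lemma add_char_sum: "add_char (sum f A) = (\<Prod>x\<in>A. add_char (f x))"
  by (induction A rule: infinite_finite_induct) (auto simp: add_char_add)

lemma fourier_conv_add_char:
  "fourier \<mu> \<alpha> = (\<Sum>\<xi>\<in>UNIV. complex_of_real (pmf \<mu> \<xi>) * add_char (- \<alpha> * \<xi>))"
  by (simp add: fourier_def add_char_def)

text \<open>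
  A trivial character would make every Fourier coefficient equal to \<open>1\<close>, so the Fourier bound
  already contains the nontriviality on which orthogonality rests.
\<close>

lemma add_char_nontrivial:
  fixes \<alpha> :: "'a::finite_field"
  assumes "norm (fourier \<mu> \<alpha>) < 1"
  shows "\<exists>x::'a. add_char x \<noteq> 1"
proof (rule ccontr)
  assume "\<not> ?thesis"
  then have "fourier \<mu> \<alpha> = of_real (\<Sum>\<xi>\<in>UNIV. pmf \<mu> \<xi>)"
    by (simp add: fourier_conv_add_char)
  also have "(\<Sum>\<xi>\<in>UNIV. pmf \<mu> \<xi>) = 1" by (rule sum_pmf_eq_1) auto
  finally show False using assms by simp
qed

lemma sum_add_char:
  fixes r :: "'a::finite_field"
  assumes "\<exists>x::'a. add_char x \<noteq> 1"
  shows "(\<Sum>x\<in>UNIV. add_char (x * r)) = (if r = 0 then of_nat CARD('a) else 0)"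
proof (cases "r = 0")
  case False
  from assms obtain x0 :: 'a where x0: "add_char x0 \<noteq> 1" by blast
  let ?S = "\<Sum>x\<in>UNIV. add_char (x * r)"
  \<comment> \<open>Translating by \<open>x0 / r\<close> multiplies the sum by \<open>add_char x0\<close>, which differs from \<open>1\<close>.\<close>
  have "?S = (\<Sum>x\<in>UNIV. add_char ((x + x0 / r) * r))"
    by (rule sum.reindex_bij_witness[of _ "\<lambda>x. x + x0 / r" "\<lambda>x. x - x0 / r"]) auto
  moreover have "(x + x0 / r) * r = x * r + x0" for x
    using False by (simp add: field_simps)
  then have "(\<Sum>x\<in>UNIV. add_char ((x + x0 / r) * r)) = add_char x0 * ?S"
    by (simp add: add_char_add sum_distrib_left mult.commute)
  ultimately have "(add_char x0 - 1) * ?S = 0" by (simp add: algebra_simps)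
  then show ?thesis using x0 False by auto
qed simp

text \<open>
  If an atom of \<open>\<mu>\<close> had mass \<open>m > 1/2\<close>, its contribution to \<open>fourier \<mu> \<alpha>\<close>, of modulus \<open>m\<close>, could
  only be cancelled down to \<open>2 m - 1\<close> by the remaining mass.
\<close>

lemma pmf_le_of_fourier_le:
  assumes "norm (fourier \<mu> \<alpha>) \<le> c"
  shows "pmf \<mu> x \<le> (1 + c) / 2"
proof -
  let ?g = "\<lambda>\<xi>. complex_of_real (pmf \<mu> \<xi>) * add_char (- \<alpha> * \<xi>)"
  have "(\<Sum>\<xi>\<in>UNIV. pmf \<mu> \<xi>) = 1" by (rule sum_pmf_eq_1) auto
  then have one: "pmf \<mu> x + (\<Sum>\<xi>\<in>UNIV - {x}. pmf \<mu> \<xi>) = 1"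
    by (subst (asm) sum.remove[of _ x]) auto
  have "fourier \<mu> \<alpha> = ?g x + sum ?g (UNIV - {x})"
    unfolding fourier_conv_add_char by (subst sum.remove[of _ x]) auto
  then have "norm (?g x) \<le> norm (fourier \<mu> \<alpha>) + norm (sum ?g (UNIV - {x}))"
    by (metis add_diff_cancel_right' norm_triangle_ineq4)
  also have "norm (sum ?g (UNIV - {x})) \<le> (\<Sum>\<xi>\<in>UNIV - {x}. pmf \<mu> \<xi>)"
    by (rule order_trans[OF norm_sum]) (simp add: norm_mult)
  finally have "pmf \<mu> x \<le> norm (fourier \<mu> \<alpha>) + (\<Sum>\<xi>\<in>UNIV - {x}. pmf \<mu> \<xi>)"
    by (simp add: norm_mult)
  with one assms show ?thesis by simp
qed

section \<open>Equidistribution of random monic polynomials modulo a fixed polynomial\<close>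

definition monic_poly :: "nat \<Rightarrow> (nat \<Rightarrow> 'a) \<Rightarrow> 'a::finite_field poly" where
  "monic_poly n \<epsilon> = monom 1 n + (\<Sum>i<n. monom (\<epsilon> i) i)"

lemma coeff_monic_poly:
  "coeff (monic_poly n \<epsilon>) i = (if i < n then \<epsilon> i else if i = n then 1 else 0)"
  by (auto simp: monic_poly_def coeff_sum coeff_monom)

lemma degree_monic_poly [simp]: "degree (monic_poly n \<epsilon>) = n"
  by (intro antisym degree_le le_degree) (auto simp: coeff_monic_poly)

lemma monic_poly_nonzero [simp]: "monic_poly n \<epsilon> \<noteq> 0"
  by (metis coeff_0 coeff_monic_poly less_irrefl one_neq_zero)

lemma finite_set_Pi_pmf:
  "finite A \<Longrightarrow> finite (set_pmf (Pi_pmf A d p :: ('b \<Rightarrow> 'a::finite) pmf))"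
  by (rule finite_subset[OF set_Pi_pmf_subset']) (auto intro: finite_PiE_dflt)

lemma expectation_prod_Pi_pmf_finite:
  fixes f :: "'b \<Rightarrow> 'a::finite \<Rightarrow> complex"
  assumes A: "finite A"
  shows "measure_pmf.expectation (Pi_pmf A d p) (\<lambda>y. \<Prod>x\<in>A. f x (y x)) =
           (\<Prod>x\<in>A. \<Sum>v\<in>UNIV. of_real (pmf (p x) v) * f x v)"
proof -
  let ?g = "\<lambda>y. \<Prod>x\<in>A. of_real (pmf (p x) (y x)) * f x (y x)"
  have "measure_pmf.expectation (Pi_pmf A d p) (\<lambda>y. \<Prod>x\<in>A. f x (y x)) =
        (\<Sum>y\<in>PiE_dflt A d (\<lambda>_. UNIV). pmf (Pi_pmf A d p) y *\<^sub>R (\<Prod>x\<in>A. f x (y x)))"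
    using A set_Pi_pmf_subset'[OF A, of d p]
    by (intro integral_measure_pmf finite_PiE_dflt) (auto simp: PiE_dflt_def)
  also have "\<dots> = (\<Sum>y\<in>PiE_dflt A d (\<lambda>_. UNIV). ?g y)"
    using A by (intro sum.cong refl)
      (auto simp: pmf_Pi' PiE_dflt_def scaleR_conv_of_real prod.distrib)
  also have "\<dots> = (\<Sum>y\<in>(\<lambda>h. restrict h A) ` PiE_dflt A d (\<lambda>_. UNIV). ?g y)"
    by (subst sum.reindex) (force simp: inj_on_def PiE_dflt_def fun_eq_iff intro!: sum.cong prod.cong)+
  also have "\<dots> = (\<Prod>x\<in>A. \<Sum>v\<in>UNIV. of_real (pmf (p x) v) * f x v)"
    using A by (subst prod_sum_PiE) (auto simp: restrict_PiE_dflt)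
  finally show ?thesis .
qed

lemma norm_fourier_le_1: "norm (fourier \<mu> \<alpha>) \<le> 1"
proof -
  have "norm (fourier \<mu> \<alpha>) \<le> (\<Sum>\<xi>\<in>UNIV. pmf \<mu> \<xi>)"
    unfolding fourier_conv_add_char by (rule order_trans[OF norm_sum]) (simp add: norm_mult)
  also have "(\<Sum>\<xi>\<in>UNIV. pmf \<mu> \<xi>) = 1" by (rule sum_pmf_eq_1) auto
  finally show ?thesis .
qed

text \<open>
  As \<open>t\<close> is a unit modulo \<open>H\<close>, any \<open>degree H\<close> consecutive powers of \<open>t\<close> span the residues modulo
  \<open>H\<close>, so a nonzero linear functional cannot vanish on all of them.
\<close>

lemma functional_nonzero_on_window:
  fixes H :: "'a::field poly"
  assumes H0: "coeff H 0 \<noteq> 0"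
    and vanish: "\<And>i. m \<le> i \<Longrightarrow> i < m + degree H \<Longrightarrow>
                   (\<Sum>j<degree H. a j * coeff (monom 1 i mod H) j) = 0"
    and j: "j < degree H"
  shows "a j = 0"
proof -
  define N where "N = degree H"
  define L where "L = (\<lambda>f. \<Sum>j<N. a j * coeff (f mod H) j)"
  have L_sum: "L (\<Sum>l\<in>S. f l) = (\<Sum>l\<in>S. L (f l))" for S and f :: "nat \<Rightarrow> 'a poly"
    by (induction S rule: infinite_finite_induct)
       (simp_all add: L_def poly_mod_add_left distrib_left sum.distrib)
  have L_smult: "L (smult x f) = x * L f" for x f
    by (simp add: L_def mod_smult_left sum_distrib_left mult_ac)
  obtain h0 H1 where H: "H = pCons h0 H1" by (cases H)
  have h0: "h0 \<noteq> 0" using H0 by (simp add: H)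
  let ?t = "monom (1::'a) 1"
  \<comment> \<open>The inverse of \<open>t\<close> modulo \<open>H\<close>.\<close>
  define V where "V = smult (- inverse h0) H1"
  have "?t * V = 1 - smult (inverse h0) H"
    using h0 by (simp add: V_def H monom_Suc one_pCons)
  then have "[?t * V = 1] (mod H)"
    by (simp add: cong_iff_dvd_diff dvd_smult)
  then have "[(?t * V) ^ m * monom 1 j = 1 ^ m * monom 1 j] (mod H)"
    by (intro cong_mult cong_pow cong_refl)
  moreover define u where "u = (V ^ m * monom 1 j) mod H"
  have "[?t ^ m * u = ?t ^ m * (V ^ m * monom 1 j)] (mod H)"
    unfolding u_def by (intro cong_mult cong_refl) (simp add: cong_def)
  ultimately have "[?t ^ m * u = monom 1 j] (mod H)"
    by (metis (no_types, lifting) cong_trans mult.assoc mult_1 power_mult_distrib power_one)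
  then have "L (?t ^ m * u) = L (monom 1 j)" by (simp add: L_def cong_def)
  moreover have "L (monom 1 j) = a j"
  proof -
    have "monom 1 j mod H = (monom 1 j :: 'a poly)"
      using j by (intro mod_poly_less) (simp add: degree_monom_eq)
    then show ?thesis using j by (simp add: L_def coeff_monom N_def if_distrib[of "(*) _"] cong: if_cong)
  qed
  moreover have "L (?t ^ m * u) = 0"
  proof -
    have "degree u < N"
      using degree_mod_less'[of H "V ^ m * monom 1 j"] j H0
      by (cases "u = 0"; cases "H = 0") (auto simp: u_def N_def)
    then have "u = (\<Sum>l<N. monom (coeff u l) l)"
      by (intro poly_eqI) (auto simp: coeff_sum coeff_monom coeff_eq_0)
    then have "?t ^ m * u = ?t ^ m * (\<Sum>l<N. monom (coeff u l) l)" by simp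
    also have "\<dots> = (\<Sum>l<N. smult (coeff u l) (monom 1 (m + l)))"
      by (simp add: sum_distrib_left monom_power mult_monom smult_monom)
    finally have "L (?t ^ m * u) = (\<Sum>l<N. coeff u l * L (monom 1 (m + l)))"
      by (simp add: L_sum L_smult)
    also have "\<dots> = 0"
      by (rule sum.neutral) (use vanish in \<open>auto simp: L_def N_def\<close>)
    finally show ?thesis .
  qed
  ultimately show ?thesis by simp
qed

text \<open>The range \<open>{b..<n}\<close> contains \<open>(n - b) div N\<close> disjoint windows of length \<open>N\<close>.\<close>

lemma card_nonzero_ge_of_windows:
  fixes s :: "nat \<Rightarrow> 'a::zero"
  assumes "\<And>m. \<exists>i. m \<le> i \<and> i < m + N \<and> s i \<noteq> 0"
  shows "(n - b) div N \<le> card {i \<in> {b..<n}. s i \<noteq> 0}"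
proof -
  obtain g where g: "\<And>m. m \<le> g m \<and> g m < m + N \<and> s (g m) \<noteq> 0"
    using assms by metis
  define M where "M = (n - b) div N"
  let ?h = "\<lambda>k. g (b + k * N)"
  have "?h k < ?h l" if "k < l" for k l
  proof -
    have "k * N + N \<le> l * N" using that by (metis add.commute mult_Suc mult_le_mono1 Suc_leI)
    then show ?thesis using g[of "b + k * N"] g[of "b + l * N"] by linarith
  qed
  then have "inj_on ?h {..<M}"
    by (intro inj_onI) (metis nat_neq_iff)
  moreover have "?h ` {..<M} \<subseteq> {i \<in> {b..<n}. s i \<noteq> 0}"
  proof
    fix i assume "i \<in> ?h ` {..<M}"
    then obtain k where k: "k < M" "i = ?h k" by auto
    have "k * N + N \<le> M * N" using k by (metis add.commute mult_Suc mult_le_mono1 Suc_leI)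
    also have "M * N \<le> n - b" by (simp add: M_def)
    finally show "i \<in> {i \<in> {b..<n}. s i \<noteq> 0}" using g[of "b + k * N"] k by auto
  qed
  ultimately have "card {..<M} \<le> card {i \<in> {b..<n}. s i \<noteq> 0}"
    by (intro card_inj_on_le) auto
  then show ?thesis by (simp add: M_def)
qed

text \<open>
  Expand the indicator of \<open>f mod H = 0\<close> into additive characters of the coefficients of
  \<open>f mod H\<close>. The trivial character gives the main term. For a nontrivial one the expectation
  factors over the independent coefficients of \<open>f\<close>, and at least one in any \<open>degree H\<close>
  consecutive coefficients contributes a nontrivial Fourier coefficient.
\<close>

lemma prob_dvd_monic_poly_approx:
  fixes \<mu> :: "nat \<Rightarrow> 'a::finite_field pmf" and H :: "'a poly"
  assumes H0: "coeff H 0 \<noteq> 0"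
    and F: "\<And>i \<alpha>. 2 \<le> i \<Longrightarrow> i < n \<Longrightarrow> \<alpha> \<noteq> 0 \<Longrightarrow> norm (fourier (\<mu> i) \<alpha>) \<le> c"
    and c: "0 \<le> c" "c < 1" and n: "2 < n"
  shows "\<bar>measure_pmf.prob (Pi_pmf {..<n} 0 \<mu>) {\<epsilon>. H dvd monic_poly n \<epsilon>} -
            1 / real CARD('a) ^ degree H\<bar> \<le> c ^ ((n - 2) div degree H)"
proof -
  define N where "N = degree H"
  define q where "q = CARD('a)"
  have q: "q > 0" by (simp add: q_def)
  define \<Omega> where "\<Omega> = Pi_pmf {..<n} 0 \<mu>"
  have fin: "finite (set_pmf \<Omega>)" unfolding \<Omega>_def by (rule finite_set_Pi_pmf) simp
  have "H \<noteq> 0" using H0 by auto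
  have nontriv: "\<exists>x::'a. add_char x \<noteq> 1"
    by (rule add_char_nontrivial[of "\<mu> 2" 1]) (use F[of 2 1] c n in auto)
  \<comment> \<open>\<open>s a i\<close> is the value at \<open>t ^ i\<close> of the functional on residues modulo \<open>H\<close> given by \<open>a\<close>.\<close>
  define r where "r = (\<lambda>i j. coeff (monom (1::'a) i mod H) j)"
  define s where "s = (\<lambda>a i. \<Sum>j<N. a j * r i j)"
  define A where "A = PiE {..<N} (\<lambda>_. UNIV :: 'a set)"
  define z where "z = (\<lambda>j\<in>{..<N}. 0::'a)"
  have zA: "z \<in> A" by (auto simp: A_def z_def)
  have finA: "finite A" unfolding A_def by (intro finite_PiE) auto
  have cardA: "card A = q ^ N" by (simp add: A_def card_PiE q_def)
  have coeff_mod: "coeff (monic_poly n \<epsilon> mod H) j = r n j + (\<Sum>i<n. \<epsilon> i * r i j)" for \<epsilon> j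
  proof -
    have "(\<Sum>i<n. monom (\<epsilon> i) i) mod H = (\<Sum>i<n. monom (\<epsilon> i) i mod H)"
      by (induction n) (simp_all add: poly_mod_add_left)
    moreover have "monom (\<epsilon> i) i mod H = smult (\<epsilon> i) (monom 1 i mod H)" for i
      by (simp add: smult_monom flip: mod_smult_left)
    ultimately show ?thesis by (simp add: monic_poly_def poly_mod_add_left coeff_sum r_def)
  qed
  have indicator: "complex_of_real (indicator {\<epsilon>. H dvd monic_poly n \<epsilon>} \<epsilon>) =
      (1 / of_nat q ^ N) * (\<Sum>a\<in>A. add_char (s a n) * (\<Prod>i<n. add_char (s a i * \<epsilon> i)))" for \<epsilon>
  proof -
    let ?c = "coeff (monic_poly n \<epsilon> mod H)"
    have dvd_iff: "H dvd monic_poly n \<epsilon> \<longleftrightarrow> (\<forall>j<N. ?c j = 0)"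
    proof
      assume *: "\<forall>j<N. ?c j = 0"
      have "?c j = 0" for j
      proof (cases "j < N")
        case False
        then show ?thesis
          using degree_mod_less[OF \<open>H \<noteq> 0\<close>, of "monic_poly n \<epsilon>"]
          by (auto simp: N_def coeff_eq_0)
      qed (use * in auto)
      then have "monic_poly n \<epsilon> mod H = 0" by (intro poly_eqI) simp
      then show "H dvd monic_poly n \<epsilon>" by (simp add: mod_eq_0_iff_dvd)
    qed (simp add: mod_eq_0_iff_dvd[THEN iffD2])
    have "(\<Sum>a\<in>A. add_char (s a n) * (\<Prod>i<n. add_char (s a i * \<epsilon> i))) =
          (\<Sum>a\<in>A. \<Prod>j<N. add_char (a j * ?c j))"
    proof (intro sum.cong refl)
      fix a
      have "add_char (s a n) * (\<Prod>i<n. add_char (s a i * \<epsilon> i)) =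
            add_char (s a n + (\<Sum>i<n. s a i * \<epsilon> i))"
        by (simp add: add_char_add add_char_sum)
      also have "s a n + (\<Sum>i<n. s a i * \<epsilon> i) = (\<Sum>j<N. a j * ?c j)"
      proof -
        have "(\<Sum>i<n. s a i * \<epsilon> i) = (\<Sum>i<n. \<Sum>j<N. a j * (\<epsilon> i * r i j))"
          unfolding s_def sum_distrib_right by (simp add: mult_ac)
        also have "\<dots> = (\<Sum>j<N. \<Sum>i<n. a j * (\<epsilon> i * r i j))" by (rule sum.swap)
        finally show ?thesis
          by (simp add: s_def coeff_mod distrib_left sum.distrib sum_distrib_left)
      qed
      finally show "add_char (s a n) * (\<Prod>i<n. add_char (s a i * \<epsilon> i)) =
          (\<Prod>j<N. add_char (a j * ?c j))" by (simp add: add_char_sum)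
    qed
    also have "\<dots> = (\<Prod>j<N. \<Sum>x\<in>UNIV. add_char (x * ?c j))"
      unfolding A_def by (subst prod_sum_PiE) auto
    also have "\<dots> = (\<Prod>j<N. if ?c j = 0 then of_nat q else 0)"
      unfolding q_def by (simp add: sum_add_char[OF nontriv])
    also have "\<dots> = (if H dvd monic_poly n \<epsilon> then of_nat q ^ N else 0)"
      by (auto simp: dvd_iff)
    finally show ?thesis using q by (simp add: indicator_def)
  qed
  define T where "T = (\<lambda>a. add_char (s a n) * (\<Prod>i<n. fourier (\<mu> i) (- s a i)))"
  have "complex_of_real (measure_pmf.prob \<Omega> {\<epsilon>. H dvd monic_poly n \<epsilon>}) =
        measure_pmf.expectation \<Omega> (\<lambda>\<epsilon>. complex_of_real (indicator {\<epsilon>. H dvd monic_poly n \<epsilon>} \<epsilon>))"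
    by simp
  also have "\<dots> = (1 / of_nat q ^ N) * (\<Sum>a\<in>A. add_char (s a n) *
                measure_pmf.expectation \<Omega> (\<lambda>\<epsilon>. \<Prod>i<n. add_char (s a i * \<epsilon> i)))"
    unfolding indicator
    by (subst integral_mult_right_zero, subst Bochner_Integration.integral_sum)
       (auto intro!: integrable_measure_pmf_finite fin simp: integral_mult_right_zero)
  also have "\<dots> = (1 / of_nat q ^ N) * (\<Sum>a\<in>A. T a)"
    unfolding \<Omega>_def
    by (subst expectation_prod_Pi_pmf_finite) (simp_all add: T_def fourier_conv_add_char)
  also have "(\<Sum>a\<in>A. T a) = 1 + (\<Sum>a\<in>A - {z}. T a)"
  proof -
    have "s z i = 0" for i by (simp add: s_def z_def)
    moreover have "fourier (\<mu> i) 0 = 1" for i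
    proof -
      have "(\<Sum>\<xi>\<in>UNIV. pmf (\<mu> i) \<xi>) = 1" by (rule sum_pmf_eq_1) auto
      then show ?thesis by (simp add: fourier_conv_add_char flip: of_real_sum)
    qed
    ultimately have "T z = 1" by (simp add: T_def)
    then show ?thesis using finA zA by (simp add: sum.remove)
  qed
  finally have P: "complex_of_real (measure_pmf.prob \<Omega> {\<epsilon>. H dvd monic_poly n \<epsilon>}) - 1 / of_nat q ^ N =
      (1 / of_nat q ^ N) * (\<Sum>a\<in>A - {z}. T a)"
    by (simp add: algebra_simps)
  have T: "norm (T a) \<le> c ^ ((n - 2) div N)" if a: "a \<in> A - {z}" for a
  proof -
    define I where "I = {i \<in> {2..<n}. s a i \<noteq> 0}"
    have window: "\<exists>i. m \<le> i \<and> i < m + N \<and> s a i \<noteq> 0" for m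
    proof (rule ccontr)
      assume "\<not> ?thesis"
      then have "a j = 0" if "j < N" for j
        using functional_nonzero_on_window[OF H0, of m a j] that by (auto simp: s_def r_def N_def)
      moreover have "a j = undefined" if "\<not> j < N" for j
        using a that PiE_arb[of a "{..<N}" "\<lambda>_. UNIV" j] by (simp add: A_def)
      ultimately have "a = z" by (simp add: z_def fun_eq_iff restrict_def)
      with a show False by simp
    qed
    have "norm (T a) = (\<Prod>i<n. norm (fourier (\<mu> i) (- s a i)))"
      by (simp add: T_def norm_mult prod_norm)
    also have "\<dots> \<le> (\<Prod>i<n. if i \<in> I then c else 1)"
      by (intro prod_mono) (auto simp: I_def norm_fourier_le_1 intro!: F)
    also have "\<dots> = c ^ card I"
      by (subst prod.If_cases) (auto simp: I_def Int_def intro!: arg_cong[where f = "\<lambda>S. c ^ card S"])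
    also have "\<dots> \<le> c ^ ((n - 2) div N)"
      using card_nonzero_ge_of_windows[where s = "s a" and N = N and b = 2 and n = n] window c
      by (intro power_decreasing) (auto simp: I_def)
    finally show ?thesis .
  qed
  have "\<bar>measure_pmf.prob \<Omega> {\<epsilon>. H dvd monic_poly n \<epsilon>} - 1 / real q ^ N\<bar> =
        norm (complex_of_real (measure_pmf.prob \<Omega> {\<epsilon>. H dvd monic_poly n \<epsilon>}) - 1 / of_nat q ^ N)"
    by (subst norm_of_real[symmetric, where 'a = complex]) simp
  also have "\<dots> \<le> (1 / real q ^ N) * (\<Sum>a\<in>A - {z}. norm (T a))"
    unfolding P by (simp add: norm_mult norm_divide norm_power divide_right_mono sum_norm_le)
  also have "\<dots> \<le> (1 / real q ^ N) * (\<Sum>a\<in>A. c ^ ((n - 2) div N))"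
    using c finA by (intro mult_left_mono order_trans[OF sum_mono[OF T] sum_mono2]) auto
  also have "\<dots> = c ^ ((n - 2) div N)" using q by (simp add: cardA)
  finally show ?thesis by (simp add: \<Omega>_def N_def q_def)
qed

section \<open>Monic polynomials and the Moebius function\<close>

definition monics :: "nat \<Rightarrow> 'a::finite_field poly set" where
  "monics d = {m. lead_coeff m = 1 \<and> degree m = d}"

lemma monics_conv_image:
  "monics d = monic_poly d ` (PiE {..<d} (\<lambda>_. UNIV :: 'a::finite_field set))"
proof (intro equalityI subsetI)
  fix m :: "'a poly" assume m: "m \<in> monics d"
  have "m = monic_poly d (restrict (coeff m) {..<d})"
    using m by (intro poly_eqI) (auto simp: coeff_monic_poly monics_def coeff_eq_0)
  then show "m \<in> monic_poly d ` (PiE {..<d} (\<lambda>_. UNIV))" by auto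
next
  fix m :: "'a poly" assume "m \<in> monic_poly d ` (PiE {..<d} (\<lambda>_. UNIV))"
  then obtain x where "m = monic_poly d x" by blast
  then show "m \<in> monics d" by (simp add: monics_def coeff_monic_poly)
qed

lemma monics_disjoint: "d \<noteq> e \<Longrightarrow> monics d \<inter> monics e = {}"
  by (auto simp: monics_def)

lemma finite_monics [simp]: "finite (monics d)"
  unfolding monics_conv_image by (intro finite_imageI finite_PiE) auto

lemma card_monics: "card (monics d :: 'a::finite_field poly set) = CARD('a) ^ d"
proof -
  have "inj_on (monic_poly d) (PiE {..<d} (\<lambda>_. UNIV :: 'a set))"
  proof (rule inj_onI)
    fix x y :: "nat \<Rightarrow> 'a"
    assume *: "x \<in> PiE {..<d} (\<lambda>_. UNIV)" "y \<in> PiE {..<d} (\<lambda>_. UNIV)" "monic_poly d x = monic_poly d y"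
    have "x i = y i" if "i < d" for i
      using arg_cong[OF *(3), of "\<lambda>f. coeff f i"] that by (simp add: coeff_monic_poly)
    then show "x = y" by (intro PiE_ext[OF *(1,2)]) simp
  qed
  then show ?thesis unfolding monics_conv_image by (simp add: card_image card_PiE)
qed

lemma monics_0 [simp]: "monics 0 = {1}"
  by (auto simp: monics_def elim!: degree_eq_zeroE)

lemma finite_monics_UN [simp]: "finite (\<Union>d\<le>k. monics d)"
  by auto

lemma finite_monic_divisors:
  assumes "(f :: 'a::finite_field poly) \<noteq> 0"
  shows "finite {m. lead_coeff m = 1 \<and> m dvd f}"
  by (rule finite_subset[OF _ finite_monics_UN[of "degree f"]])
     (use assms in \<open>auto simp: monics_def dvd_imp_degree_le\<close>)

lemma monic_dvd_antisym:
  fixes f g :: "'a::field poly"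
  assumes "lead_coeff f = 1" "lead_coeff g = 1" "f dvd g" "degree g \<le> degree f"
  shows "f = g"
proof -
  from assms(3) obtain h where h: "g = f * h" by (elim dvdE)
  with assms have "lead_coeff h = 1" by (simp add: lead_coeff_mult)
  moreover have "degree h = 0"
    using assms calculation h degree_mult_eq[of f h] by (cases "h = 0 \<or> f = 0") auto
  ultimately show ?thesis using h by (auto elim!: degree_eq_zeroE)
qed

definition monic_irred :: "'a::field poly \<Rightarrow> bool" where
  "monic_irred P \<longleftrightarrow> irreducible P \<and> lead_coeff P = 1"

lemma monic_irredD:
  assumes "monic_irred P"
  shows "irreducible P" "prime_elem P" "lead_coeff P = 1" "P \<noteq> 0" "degree P > 0"
proof -
  show P: "irreducible P" "lead_coeff P = 1" using assms by (auto simp: monic_irred_def)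
  from P(1) show "prime_elem P" by (rule field_poly_irreducible_imp_prime)
  show "P \<noteq> 0" using P by auto
  then show "degree P > 0" using irreducible_not_unit[OF P(1)] by (simp add: is_unit_iff_degree)
qed

lemma monic_irred_dvd_imp_eq:
  assumes "monic_irred P" "monic_irred Q" "P dvd Q"
  shows "P = Q"
proof -
  note P = monic_irredD[OF assms(1)] and Q = monic_irredD[OF assms(2)]
  from assms(3) obtain h where h: "Q = P * h" by (elim dvdE)
  have "is_unit h" using irreducibleD[OF Q(1) h] irreducible_not_unit[OF P(1)] by simp
  then have "degree h = 0" by (elim is_unit_polyE) simp
  then have "degree Q \<le> degree P" using degree_mult_le[of P h] by (simp add: h)
  with P(3) Q(3) assms(3) show ?thesis by (intro monic_dvd_antisym)
qed

lemma exists_monic_irred_dvd: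
  fixes f :: "'a::field poly"
  assumes "degree f > 0"
  shows "\<exists>P. monic_irred P \<and> P dvd f"
  using assms
proof (induction "degree f" arbitrary: f rule: less_induct)
  case less
  show ?case
  proof (cases "irreducible f")
    case True
    let ?P = "smult (inverse (lead_coeff f)) f"
    from less have "f \<noteq> 0" by auto
    then have "irreducible ([:inverse (lead_coeff f):] * f)"
      using True by (subst irreducible_mult_unit_left) (auto simp: is_unit_pCons_iff)
    then have "irreducible ?P" by simp
    then have "monic_irred ?P" using \<open>f \<noteq> 0\<close> by (simp add: monic_irred_def)
    then show ?thesis using \<open>f \<noteq> 0\<close> by (intro exI[of _ ?P]) (simp add: smult_dvd_iff)
  next
    case False
    from less.prems have "f \<noteq> 0" by auto
    then have "\<not> is_unit f" using less.prems by (simp add: is_unit_iff_degree)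
    with False obtain a b where ab: "f = a * b" "\<not> is_unit a" "\<not> is_unit b"
      using \<open>f \<noteq> 0\<close> unfolding irreducible_def by blast
    have "a \<noteq> 0" "b \<noteq> 0" using ab(1) \<open>f \<noteq> 0\<close> by (metis mult_zero_left mult_zero_right)+
    then have "degree a > 0" "degree b > 0"
      using ab(2,3) by (simp_all add: is_unit_iff_degree)
    moreover have "degree f = degree a + degree b"
      unfolding ab(1) by (rule degree_mult_eq) fact+
    ultimately have "degree a < degree f" "degree a > 0" by linarith+
    from less.hyps[OF this] obtain P where P: "monic_irred P" "P dvd a" by blast
    from P(2) have "P dvd f" unfolding ab(1) by (rule dvd_mult2)
    with P(1) show ?thesis by blast
  qed
qed

lemma squarefree_iff_monic_irred:
  fixes f :: "'a::field poly"
  assumes "f \<noteq> 0"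
  shows "squarefree f \<longleftrightarrow> (\<forall>P. monic_irred P \<longrightarrow> \<not> P\<^sup>2 dvd f)"
proof
  assume f: "squarefree f"
  show "\<forall>P. monic_irred P \<longrightarrow> \<not> P\<^sup>2 dvd f"
  proof (intro allI impI notI)
    fix P :: "'a poly" assume P: "monic_irred P" "P\<^sup>2 dvd f"
    show False
      using squarefreeD[OF f P(2)] irreducible_not_unit[OF monic_irredD(1)[OF P(1)]] by (rule notE[rotated])
  qed
next
  assume *: "\<forall>P. monic_irred P \<longrightarrow> \<not> P\<^sup>2 dvd f"
  show "squarefree f"
  proof (rule squarefreeI, rule ccontr)
    fix x :: "'a poly" assume x: "x\<^sup>2 dvd f" "\<not> x dvd 1"
    have "x \<noteq> 0"
    proof
      assume "x = 0"
      with x(1) have "0 dvd f" by simp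
      with assms show False by simp
    qed
    then have "degree x > 0" using x(2) by (simp add: is_unit_iff_degree)
    then obtain P where P: "monic_irred P" "P dvd x" using exists_monic_irred_dvd by blast
    from dvd_trans[OF dvd_power_same[OF P(2)] x(1)] * P(1) show False by blast
  qed
qed

lemma prime_square_dvd_mult_cancel:
  fixes P :: "'a::idom"
  assumes P: "prime_elem P" and "P\<^sup>2 dvd a * b" "\<not> P dvd a"
  shows "P\<^sup>2 dvd b"
proof -
  have "P dvd a * b" using assms(2) by (metis dvd_mult_left power2_eq_square)
  with P assms(3) obtain b' where b: "b = P * b'" by (auto simp: prime_elem_dvd_mult_iff)
  with assms(2) P have "P dvd a * b'" by (simp add: power2_eq_square mult.left_commute)
  with P assms(3) show ?thesis
    by (auto simp: b power2_eq_square prime_elem_dvd_mult_iff)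
qed

lemma squarefree_monic_irred_mult:
  fixes m :: "'a::field poly"
  assumes P: "monic_irred P" and m: "squarefree m" "\<not> P dvd m"
  shows "squarefree (P * m)"
proof -
  note PD = monic_irredD[OF P]
  have "m \<noteq> 0" using m(2) by auto
  have "\<not> Q\<^sup>2 dvd P * m" if Q: "monic_irred Q" for Q
  proof
    assume Q2: "Q\<^sup>2 dvd P * m"
    show False
    proof (cases "Q dvd P")
      case True
      then have "Q = P" using monic_irred_dvd_imp_eq P Q by blast
      with Q2 PD(4) m(2) show False by (simp add: power2_eq_square)
    next
      case False
      then have "Q\<^sup>2 dvd m"
        using prime_square_dvd_mult_cancel[OF monic_irredD(2)[OF Q] Q2] by blast
      then show False using m(1) Q \<open>m \<noteq> 0\<close> squarefree_iff_monic_irred by blast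
    qed
  qed
  moreover have "P * m \<noteq> 0" using PD(4) \<open>m \<noteq> 0\<close> by simp
  ultimately show ?thesis using squarefree_iff_monic_irred by blast
qed

definition omega :: "'a::field poly \<Rightarrow> nat" where
  "omega m = card {P. monic_irred P \<and> P dvd m}"

definition mob :: "'a::field poly \<Rightarrow> real" where
  "mob m = (if squarefree m then (- 1) ^ omega m else 0)"

lemma finite_monic_irred_divisors:
  "(m :: 'a::finite_field poly) \<noteq> 0 \<Longrightarrow> finite {P. monic_irred P \<and> P dvd m}"
  by (rule finite_subset[OF _ finite_monic_divisors]) (auto simp: monic_irred_def)

lemma abs_mob_le_1: "\<bar>mob m\<bar> \<le> 1"
  by (simp add: mob_def power_abs)

lemma mob_1 [simp]: "mob 1 = 1"
proof -
  have "{P::'a poly. monic_irred P \<and> P dvd 1} = {}"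
    using monic_irredD(1) irreducible_not_unit by blast
  then have "omega (1 :: 'a poly) = 0" unfolding omega_def by (simp only: card.empty)
  then show ?thesis by (simp add: mob_def)
qed

lemma mob_monic_irred_mult:
  fixes m :: "'a::finite_field poly"
  assumes P: "monic_irred P" and m: "squarefree m" "\<not> P dvd m"
  shows "mob (P * m) = - mob m"
proof -
  have "m \<noteq> 0" using m(2) by auto
  have "Q dvd P * m \<longleftrightarrow> Q = P \<or> Q dvd m" if "monic_irred Q" for Q
    using prime_elem_dvd_mult_iff[OF monic_irredD(2)[OF that]] monic_irred_dvd_imp_eq[OF that P]
    by auto
  then have "{Q. monic_irred Q \<and> Q dvd P * m} = insert P {Q. monic_irred Q \<and> Q dvd m}"
    using P by auto
  then have "omega (P * m) = Suc (omega m)"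
    unfolding omega_def using m(2) finite_monic_irred_divisors[OF \<open>m \<noteq> 0\<close>] by simp
  then show ?thesis using squarefree_monic_irred_mult[OF P m] m(1) by (simp add: mob_def)
qed

text \<open>
  Pair each \<open>m\<close> not divisible by \<open>P\<close> with \<open>P * m\<close>: the two contributions cancel, and only those
  \<open>m\<close> survive whose partner exceeds the degree bound.
\<close>

lemma sum_mob_toggle:
  fixes G :: "'a::finite_field poly set"
  assumes P: "monic_irred P"
    and G: "\<And>m. m \<in> G \<Longrightarrow> lead_coeff m = 1 \<and> squarefree m"
    and mult: "\<And>m. m \<in> G \<Longrightarrow> \<not> P dvd m \<Longrightarrow> P * m \<in> G"
    and cancel: "\<And>m. P * m \<in> G \<Longrightarrow> m \<in> G"
  shows "(\<Sum>m | m \<in> G \<and> degree m \<le> k. mob m) =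
         (\<Sum>m | m \<in> G \<and> \<not> P dvd m \<and> degree m \<le> k \<and> k < degree m + degree P. mob m)"
proof -
  note PD = monic_irredD[OF P]
  define A where "A = {m \<in> G. \<not> P dvd m \<and> degree m + degree P \<le> k}"
  define B where "B = {m \<in> G. \<not> P dvd m \<and> degree m \<le> k \<and> k < degree m + degree P}"
  define C where "C = {m \<in> G. P dvd m \<and> degree m \<le> k}"
  have "finite {m \<in> G. degree m \<le> k}"
    by (rule finite_subset[OF _ finite_monics_UN[of k]]) (use G in \<open>auto simp: monics_def\<close>)
  then have fin: "finite A" "finite B" "finite C"
    by (auto elim!: rev_finite_subset simp: A_def B_def C_def)
  have C: "C = (\<lambda>m. P * m) ` A"
  proof (intro equalityI subsetI)
    fix m assume m: "m \<in> C"
    then obtain h where h: "m = P * h" by (auto simp: C_def)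
    have "h \<in> G" using m cancel by (auto simp: C_def h)
    moreover have "\<not> P dvd h"
    proof
      assume "P dvd h"
      then have "P\<^sup>2 dvd m" by (simp add: h power2_eq_square)
      then show False using m G PD by (metis (no_types, lifting) C_def mem_Collect_eq
          squarefreeD irreducible_not_unit)
    qed
    moreover have "h \<noteq> 0" using \<open>\<not> P dvd h\<close> by auto
    ultimately have "h \<in> A" using m PD by (auto simp: A_def C_def h degree_mult_eq)
    then show "m \<in> (\<lambda>m. P * m) ` A" using h by blast
  next
    fix m assume "m \<in> (\<lambda>m. P * m) ` A"
    then obtain h where h: "h \<in> A" "m = P * h" by auto
    then show "m \<in> C" using degree_mult_le[of P h] mult
      by (auto simp: A_def C_def intro: order_trans)
  qed
  have "inj_on (\<lambda>m. P * m) A" using PD by (auto intro: inj_onI)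
  then have "sum mob C = (\<Sum>m\<in>A. mob (P * m))" by (simp add: C sum.reindex)
  also have "\<dots> = (\<Sum>m\<in>A. - mob m)"
    by (intro sum.cong refl mob_monic_irred_mult[OF P]) (use G in \<open>auto simp: A_def\<close>)
  finally have AC: "sum mob A + sum mob C = 0" by (simp add: sum_negf)
  have "{m \<in> G. degree m \<le> k} = (A \<union> C) \<union> B" by (auto simp: A_def B_def C_def)
  then have "sum mob {m \<in> G. degree m \<le> k} = (sum mob A + sum mob C) + sum mob B"
  proof -
    have "A \<inter> C = {}" "(A \<union> C) \<inter> B = {}" by (auto simp: A_def B_def C_def)
    then show ?thesis using fin
      by (simp add: \<open>{m \<in> G. degree m \<le> k} = (A \<union> C) \<union> B\<close> sum.union_disjoint)
  qed
  with AC show ?thesis by (simp add: B_def)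
qed

text \<open>
  Toggling a prime divisor of \<open>f\<close> preserves the set of squarefree divisors of \<open>f\<close>. A degree bound
  beyond \<open>degree f\<close> leaves no unpaired divisor.
\<close>

lemma sum_mob_monic_divisors:
  fixes f :: "'a::finite_field poly"
  assumes f: "lead_coeff f = 1"
  shows "(\<Sum>m | lead_coeff m = 1 \<and> m dvd f. mob m) = (if degree f = 0 then 1 else 0)"
proof (cases "degree f = 0")
  case True
  then have "f = 1" using f by (auto elim!: degree_eq_zeroE)
  then have "{m. lead_coeff m = 1 \<and> m dvd f} = {1}"
    by (auto simp: is_unit_iff_degree elim!: is_unit_polyE)
  then show ?thesis using True by simp
next
  case False
  then obtain P where P: "monic_irred P" "P dvd f" using exists_monic_irred_dvd by blast
  have "f \<noteq> 0" using f by auto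
  define G where "G = {m. lead_coeff m = 1 \<and> squarefree m \<and> m dvd f}"
  have "(\<Sum>m | lead_coeff m = 1 \<and> m dvd f. mob m) = sum mob G"
    using finite_monic_divisors[OF \<open>f \<noteq> 0\<close>]
    by (intro sum.mono_neutral_right) (auto simp: G_def mob_def)
  also have "sum mob G = (\<Sum>m | m \<in> G \<and> degree m \<le> degree f + degree P. mob m)"
  proof (rule arg_cong[where f = "sum mob"])
    show "G = {m \<in> G. degree m \<le> degree f + degree P}"
      using \<open>f \<noteq> 0\<close> by (auto simp: G_def dest: dvd_imp_degree_le)
  qed
  also have "\<dots> = (\<Sum>m | m \<in> G \<and> \<not> P dvd m \<and> degree m \<le> degree f + degree P \<and>
                                 degree f + degree P < degree m + degree P. mob m)"
  proof (rule sum_mob_toggle[OF P(1)])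
    fix m assume m: "m \<in> G" "\<not> P dvd m"
    from m obtain h where h: "f = m * h" by (auto simp: G_def)
    then have "P dvd h" using P m monic_irredD(2) prime_elem_dvd_mult_iff by blast
    then have "P * m dvd f" by (auto simp: h mult_ac)
    then show "P * m \<in> G"
      using m P(1) monic_irredD(3)[OF P(1)] squarefree_monic_irred_mult
      by (auto simp: G_def lead_coeff_mult)
  next
    fix m assume m: "P * m \<in> G"
    then have "squarefree m" "m dvd f"
      by (auto simp: G_def dest: squarefree_multD intro: dvd_mult_right)
    then show "m \<in> G" using m monic_irredD(3)[OF P(1)] by (auto simp: G_def lead_coeff_mult)
  qed (simp add: G_def)
  also have "\<dots> = 0"
    by (rule sum.neutral) (use \<open>f \<noteq> 0\<close> in \<open>auto simp: G_def dest: dvd_imp_degree_le\<close>)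
  finally show ?thesis using False by simp
qed

lemma card_monics_nonzero_at_0:
  "real (card {m \<in> monics k. poly (m :: 'a::finite_field poly) 0 \<noteq> 0}) =
     (if k = 0 then 1 else (real CARD('a) - 1) * real CARD('a) ^ (k - 1))"
proof (cases k)
  case 0
  have "{m \<in> monics 0. poly (m :: 'a poly) 0 \<noteq> 0} = {1}" by auto
  with 0 show ?thesis by simp
next
  case (Suc l)
  have split: "monics k = {m \<in> monics k. poly (m :: 'a poly) 0 \<noteq> 0} \<union> pCons 0 ` monics l"
  proof (intro equalityI subsetI)
    fix m :: "'a poly" assume m: "m \<in> monics k"
    obtain c m' where m': "m = pCons c m'" by (cases m)
    have "m' \<in> monics l" using m by (auto simp: m' Suc monics_def split: if_splits)
    with m show "m \<in> {m \<in> monics k. poly m 0 \<noteq> 0} \<union> pCons 0 ` monics l"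
      by (cases "c = 0") (simp_all add: m')
  next
    fix m :: "'a poly" assume "m \<in> {m \<in> monics k. poly m 0 \<noteq> 0} \<union> pCons 0 ` monics l"
    then show "m \<in> monics k"
    proof
      assume "m \<in> pCons 0 ` monics l"
      then obtain m' where m': "m' \<in> monics l" "m = pCons 0 m'" by blast
      then have "m' \<noteq> 0" by (auto simp: monics_def)
      with m' show ?thesis by (auto simp: monics_def Suc)
    qed simp
  qed
  have "card (monics k :: 'a poly set) =
        card {m \<in> monics k. poly (m :: 'a poly) 0 \<noteq> 0} + card (pCons 0 ` monics l :: 'a poly set)"
    by (subst split, rule card_Un_disjoint) auto
  also have "card (pCons 0 ` monics l :: 'a poly set) = CARD('a) ^ l"
    by (subst card_image) (auto intro!: inj_onI simp: card_monics)
  finally have "real (CARD('a) ^ k) = real (card {m \<in> monics k. poly (m :: 'a poly) 0 \<noteq> 0} + CARD('a) ^ l)"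
    by (simp only: card_monics)
  then show ?thesis by (simp add: Suc algebra_simps)
qed

text \<open>
  The sums \<open>\<Sum> mob m\<close> over monic \<open>m\<close> of degree \<open>d\<close> with \<open>m 0 \<noteq> 0\<close> are the coefficients of
  \<open>(1 - q X) / (1 - X)\<close>, the inverse of the zeta function of the ring with the prime \<open>t\<close> removed.
  Accordingly, they are found from their convolution with the number of such \<open>m\<close>, which
  counts each monic \<open>f\<close> with weight \<open>\<Sum> mob m\<close> over the divisors \<open>m\<close> of \<open>f\<close>.
\<close>

lemma sum_mob_convolution:
  "(\<Sum>j\<le>e. (\<Sum>m | m \<in> monics j \<and> poly (m :: 'a::finite_field poly) 0 \<noteq> 0. mob m) *
           real (card {m \<in> monics (e - j). poly (m :: 'a poly) 0 \<noteq> 0})) =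
     (if e = 0 then 1 else 0)"
proof -
  define T where "T = (\<lambda>j. {m \<in> monics j. poly (m :: 'a poly) 0 \<noteq> 0})"
  have finT: "finite (T j)" for j by (simp add: T_def)
  define Dv where "Dv = (\<lambda>f. {m :: 'a poly. lead_coeff m = 1 \<and> m dvd f})"
  have fnz: "f \<noteq> 0" if "f \<in> T e" for f using that by (auto simp: T_def)
  have finDv: "finite (Dv f)" if "f \<in> T e" for f
    unfolding Dv_def by (rule finite_monic_divisors) (rule fnz[OF that])
  define split_off where "split_off = (\<lambda>(f, m). ((degree m, m), f div m :: 'a poly))"
  define merge where "merge = (\<lambda>((j :: nat, m), k). (m * k :: 'a poly, m))"
  have "(\<Sum>j\<le>e. sum mob (T j) * real (card (T (e - j)))) =
        (\<Sum>j\<le>e. \<Sum>m\<in>T j. \<Sum>k\<in>T (e - j). mob m)"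
    by (simp add: sum_distrib_right mult.commute)
  also have "\<dots> = (\<Sum>y\<in>Sigma {..e} T. \<Sum>k\<in>T (e - fst y). mob (snd y))"
    by (subst sum.Sigma) (simp_all add: finT case_prod_unfold)
  also have "\<dots> = (\<Sum>x\<in>Sigma (Sigma {..e} T) (\<lambda>y. T (e - fst y)). mob (snd (fst x)))"
    by (subst sum.Sigma) (simp_all add: finT case_prod_unfold)
  also have "\<dots> = (\<Sum>x\<in>Sigma (T e) Dv. mob (snd x))"
  proof (rule sum.reindex_bij_witness[of _ split_off merge])
    fix x assume x: "x \<in> Sigma (T e) Dv"
    obtain f m where fm: "x = (f, m)" by (cases x)
    with x have f: "f \<in> T e" and m: "lead_coeff m = 1" "m dvd f" by (auto simp: Dv_def)
    then obtain k where k: "f = m * k" by (elim dvdE)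
    have nz: "m \<noteq> 0" "k \<noteq> 0" using fnz[OF f] by (auto simp: k)
    have "f div m = k" using nz by (simp add: k)
    moreover have "degree m + degree k = e" using f nz by (simp add: T_def monics_def k degree_mult_eq)
    moreover have "lead_coeff k = 1" using f m by (simp add: T_def monics_def k lead_coeff_mult)
    moreover have "poly m 0 \<noteq> 0" "poly k 0 \<noteq> 0" using f by (simp_all add: T_def k)
    ultimately have *: "f div m = k" "m \<in> T (degree m)" "k \<in> T (e - degree m)" "degree m \<le> e"
      using m by (auto simp: T_def monics_def)
    show "merge (split_off x) = x"
      using * by (simp add: fm k split_off_def merge_def)
    show "split_off x \<in> Sigma (Sigma {..e} T) (\<lambda>y. T (e - fst y))"
      using * by (simp add: fm split_off_def)
  next
    fix x assume x: "x \<in> Sigma (Sigma {..e} T) (\<lambda>y. T (e - fst y))"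
    obtain j m k where jmk: "x = ((j, m), k)" by (metis surj_pair)
    with x have *: "j \<le> e" "m \<in> T j" "k \<in> T (e - j)" by auto
    then have nz: "m \<noteq> 0" "k \<noteq> 0" and l: "lead_coeff m = 1" "lead_coeff k = 1"
      and d: "degree m = j" "degree k = e - j"
      by (auto simp: T_def monics_def)
    show "split_off (merge x) = x"
      using nz d by (simp add: jmk split_off_def merge_def)
    have "lead_coeff (m * k) = 1" using l by (simp only: lead_coeff_mult mult_1_left)
    moreover have "degree (m * k) = e" using nz d *(1) by (simp add: degree_mult_eq)
    moreover have "poly (m * k) 0 \<noteq> 0" using * by (simp add: T_def)
    ultimately have "m * k \<in> T e" by (simp add: T_def monics_def)
    then show "merge x \<in> Sigma (T e) Dv"
      using l by (simp add: jmk Dv_def merge_def)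
    show "mob (snd (merge x)) = mob (snd (fst x))"
      by (simp add: jmk merge_def)
  qed
  also have "\<dots> = (\<Sum>f\<in>T e. sum mob (Dv f))"
    by (subst sum.Sigma) (simp_all add: finT finDv case_prod_unfold)
  also have "\<dots> = (\<Sum>f\<in>T e. if e = 0 then 1 else 0)"
  proof (intro sum.cong refl)
    fix f assume "f \<in> T e"
    then have "lead_coeff f = 1" "degree f = e" by (auto simp: T_def monics_def)
    then show "sum mob (Dv f) = (if e = 0 then 1 else 0)"
      unfolding Dv_def using sum_mob_monic_divisors[of f] by simp
  qed
  also have "\<dots> = (if e = 0 then 1 else 0)" by (auto simp: T_def cong: conj_cong)
  finally show ?thesis unfolding T_def .
qed

lemma sum_mob_monics:
  "(\<Sum>m | m \<in> monics d \<and> poly (m :: 'a::finite_field poly) 0 \<noteq> 0. mob m) =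
     (if d = 0 then 1 else 1 - real CARD('a))"
proof (induction d rule: less_induct)
  case (less e)
  define q where "q = real CARD('a)"
  define S where "S = (\<lambda>j. \<Sum>m | m \<in> monics j \<and> poly (m :: 'a poly) 0 \<noteq> 0. mob m)"
  define N where "N = (\<lambda>k. real (card {m \<in> monics k. poly (m :: 'a poly) 0 \<noteq> 0}))"
  have N: "N k = (if k = 0 then 1 else (q - 1) * q ^ (k - 1))" for k
    unfolding N_def q_def by (rule card_monics_nonzero_at_0)
  have conv: "(\<Sum>j\<le>e. S j * N (e - j)) = (if e = 0 then 1 else 0)"
    unfolding S_def N_def by (rule sum_mob_convolution)
  have IH: "S j = (if j = 0 then 1 else 1 - q)" if "j < e" for j
    unfolding S_def q_def using less that by blast
  have "S e = (if e = 0 then 1 else 1 - q)"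
  proof (cases e)
    case 0
    then show ?thesis using conv by (simp add: N)
  next
    case (Suc k)
    have "(\<Sum>j\<le>e. S j * N (e - j)) = S e + (\<Sum>j<e. S j * N (e - j))"
      by (simp add: lessThan_Suc_atMost[symmetric] N)
    also have "(\<Sum>j<e. S j * N (e - j)) = N e + (\<Sum>j<k. (1 - q) * N (k - j))"
      unfolding Suc by (subst sum.lessThan_Suc_shift) (simp add: IH Suc)
    also have "(\<Sum>j<k. (1 - q) * N (k - j)) = (\<Sum>i<k. (1 - q) * N (Suc i))"
      by (subst sum.nat_diff_reindex[symmetric]) (intro sum.cong, auto simp: Suc_diff_Suc)
    also have "\<dots> = (1 - q) * ((q - 1) * (\<Sum>i<k. q ^ i))"
      by (simp add: N sum_distrib_left)
    also have "(q - 1) * (\<Sum>i<k. q ^ i) = q ^ k - 1" by (simp add: power_diff_1_eq)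
    finally show ?thesis using conv by (simp add: N Suc algebra_simps)
  qed
  then show ?case by (simp add: S_def q_def)
qed

section \<open>The sieve by squares of small primes\<close>

text \<open>
  The index set of the Moebius sums of the sieve. The condition \<open>poly m 0 \<noteq> 0\<close> excludes the prime \<open>t\<close>,
  whose square is governed by the two lowest coefficients alone.
\<close>

definition smooth_squarefree :: "nat \<Rightarrow> 'a::finite_field poly set" where
  "smooth_squarefree D = {m. lead_coeff m = 1 \<and> squarefree m \<and> poly m 0 \<noteq> 0 \<and>
     (\<forall>P. monic_irred P \<longrightarrow> P dvd m \<longrightarrow> degree P < D)}"

lemma smooth_squarefree_cancel:
  assumes "P * m \<in> smooth_squarefree D" "lead_coeff P = 1"
  shows "m \<in> smooth_squarefree D"
  using assms unfolding smooth_squarefree_def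
  by (auto simp: lead_coeff_mult dest: squarefree_multD)

lemma smooth_squarefree_mult:
  assumes m: "m \<in> smooth_squarefree D" "\<not> P dvd m"
    and P: "monic_irred P" "poly P 0 \<noteq> 0" "degree P < D"
  shows "P * m \<in> smooth_squarefree D"
proof -
  have "degree Q < D" if Q: "monic_irred Q" "Q dvd P * m" for Q
  proof -
    from Q have "Q dvd P \<or> Q dvd m"
      using prime_elem_dvd_mult_iff[OF monic_irredD(2)[OF Q(1)]] by blast
    then show ?thesis
      using monic_irred_dvd_imp_eq[OF Q(1) P(1)] P(3) m(1) Q(1) by (auto simp: smooth_squarefree_def)
  qed
  moreover have "squarefree (P * m)"
    using m squarefree_monic_irred_mult[OF P(1)] by (auto simp: smooth_squarefree_def)
  ultimately show ?thesis
    using m monic_irredD(3)[OF P(1)] P(2) by (simp add: smooth_squarefree_def lead_coeff_mult)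
qed

lemma finite_smooth_squarefree_le: "finite {m \<in> smooth_squarefree D. degree m \<le> k}"
  by (rule finite_subset[OF _ finite_monics_UN[of k]]) (auto simp: smooth_squarefree_def monics_def)

definition no_square_below :: "nat \<Rightarrow> 'a::field poly \<Rightarrow> bool" where
  "no_square_below D f \<longleftrightarrow>
     (\<forall>P. monic_irred P \<longrightarrow> poly P 0 \<noteq> 0 \<longrightarrow> degree P < D \<longrightarrow> \<not> P\<^sup>2 dvd f)"

text \<open>
  The Moebius sum is cut off at degree \<open>k\<close>. If the square of some prime \<open>P\<close> divides \<open>f\<close>, toggling \<open>P\<close>
  cancels all of it except for terms whose degree is within \<open>degree P < D\<close> of the cutoff.
\<close>

lemma truncated_sieve_error:
  fixes f :: "'a::finite_field poly"
  shows "\<bar>of_bool (no_square_below D f) -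
            (\<Sum>m | m \<in> smooth_squarefree D \<and> degree m \<le> k. mob m * of_bool (m\<^sup>2 dvd f))\<bar>
         \<le> (\<Sum>m | m \<in> smooth_squarefree D \<and> degree m \<le> k \<and> k < degree m + D. of_bool (m\<^sup>2 dvd f))"
proof -
  define G where "G = {m \<in> smooth_squarefree D. m\<^sup>2 dvd f}"
  have main: "(\<Sum>m | m \<in> smooth_squarefree D \<and> degree m \<le> k. mob m * of_bool (m\<^sup>2 dvd f)) =
        (\<Sum>m | m \<in> G \<and> degree m \<le> k. mob m)"
    using finite_smooth_squarefree_le[of D k]
    by (intro sum.mono_neutral_cong_right) (auto simp: G_def)
  have err: "(\<Sum>m | m \<in> smooth_squarefree D \<and> degree m \<le> k \<and> k < degree m + D. of_bool (m\<^sup>2 dvd f)) =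
        real (card {m \<in> G. degree m \<le> k \<and> k < degree m + D})"
  proof -
    have "finite {m \<in> smooth_squarefree D. degree m \<le> k \<and> k < degree (m :: 'a poly) + D}"
      by (rule finite_subset[OF _ finite_smooth_squarefree_le[of D k]]) auto
    then have "(\<Sum>m | m \<in> smooth_squarefree D \<and> degree m \<le> k \<and> k < degree m + D. of_bool (m\<^sup>2 dvd f)) =
        (\<Sum>m | m \<in> G \<and> degree m \<le> k \<and> k < degree m + D. 1 :: real)"
      by (intro sum.mono_neutral_cong_right) (auto simp: G_def)
    then show ?thesis by simp
  qed
  have finG: "finite {m \<in> G. degree m \<le> k}"
    by (rule finite_subset[OF _ finite_smooth_squarefree_le[of D k]]) (auto simp: G_def)
  show ?thesis
  proof (cases "no_square_below D f")
    case True
    have "m = 1" if "m \<in> G" for m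
    proof (rule ccontr)
      assume "m \<noteq> 1"
      have m: "lead_coeff m = 1" "poly m 0 \<noteq> 0" "m\<^sup>2 dvd f"
        and sm: "\<And>P. monic_irred P \<Longrightarrow> P dvd m \<Longrightarrow> degree P < D"
        using that by (auto simp: G_def smooth_squarefree_def)
      have "degree m > 0"
        using m(1) \<open>m \<noteq> 1\<close> by (cases "degree m = 0") (auto elim!: degree_eq_zeroE)
      then obtain P where P: "monic_irred P" "P dvd m" using exists_monic_irred_dvd by blast
      from P(2) m(2) have "poly P 0 \<noteq> 0" by (auto elim!: dvdE)
      moreover have "P\<^sup>2 dvd f" by (rule dvd_trans[OF dvd_power_same[OF P(2)] m(3)])
      ultimately show False using True P(1) sm[OF P] by (auto simp: no_square_below_def)
    qed
    moreover have "1 \<in> G"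
      using monic_irredD(1) irreducible_not_unit by (auto simp: G_def smooth_squarefree_def)
    ultimately have "{m \<in> G. degree m \<le> k} = {1}" by auto
    then have "(\<Sum>m | m \<in> G \<and> degree m \<le> k. mob m) = 1" by simp
    then show ?thesis unfolding main err using True by simp
  next
    case False
    then obtain P where P: "monic_irred P" "poly P 0 \<noteq> 0" "degree P < D" "P\<^sup>2 dvd f"
      by (auto simp: no_square_below_def)
    have "(\<Sum>m | m \<in> G \<and> degree m \<le> k. mob m) =
         (\<Sum>m | m \<in> G \<and> \<not> P dvd m \<and> degree m \<le> k \<and> k < degree m + degree P. mob m)"
    proof (rule sum_mob_toggle[OF P(1)])
      fix m assume m: "m \<in> G" "\<not> P dvd m"
      from m(1) obtain h where h: "f = m\<^sup>2 * h" by (auto simp: G_def)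
      have "\<not> P dvd m\<^sup>2"
        using m(2) prime_elem_dvd_power[OF monic_irredD(2)[OF P(1)]] by blast
      then have "P\<^sup>2 dvd h"
        using prime_square_dvd_mult_cancel[OF monic_irredD(2)[OF P(1)]] P(4) unfolding h by blast
      then have "(P * m)\<^sup>2 dvd f"
        unfolding h power_mult_distrib by (subst mult.commute) (intro mult_dvd_mono dvd_refl)
      then show "P * m \<in> G"
        using m smooth_squarefree_mult P by (auto simp: G_def)
    next
      fix m assume m: "P * m \<in> G"
      then have "m\<^sup>2 dvd f"
        by (auto simp: G_def power_mult_distrib intro: dvd_mult_right)
      then show "m \<in> G"
        using m smooth_squarefree_cancel monic_irredD(3)[OF P(1)] by (auto simp: G_def)
    qed (auto simp: G_def smooth_squarefree_def)
    also have "\<bar>\<dots>\<bar> \<le> (\<Sum>m | m \<in> G \<and> \<not> P dvd m \<and> degree m \<le> k \<and> k < degree m + degree P. 1)"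
      by (rule order_trans[OF sum_abs sum_mono]) (rule abs_mob_le_1)
    also have "\<dots> = real (card {m \<in> G. \<not> P dvd m \<and> degree m \<le> k \<and> k < degree m + degree P})" by simp
    also have "\<dots> \<le> real (card {m \<in> G. degree m \<le> k \<and> k < degree m + D})"
      using P(3) by (intro of_nat_mono card_mono finite_subset[OF _ finG]) auto
    finally show ?thesis unfolding main err using False by simp
  qed
qed

section \<open>Squares of large primes\<close>

lemma card_monic_irred_divisors_le_degree:
  fixes g :: "'a::finite_field poly"
  assumes "g \<noteq> 0"
  shows "card {P. monic_irred P \<and> P dvd g} \<le> degree g"
  using assms
proof (induction "degree g" arbitrary: g rule: less_induct)
  case less
  show ?case
  proof (cases "\<exists>P. monic_irred P \<and> P dvd g")
    case False
    then have "{P. monic_irred P \<and> P dvd g} = {}" by blast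
    then show ?thesis by (simp only: card.empty)
  next
    case True
    then obtain P where P: "monic_irred P" "P dvd g" by blast
    then obtain h where h: "g = P * h" by (elim dvdE)
    have nz: "h \<noteq> 0" using less.prems by (simp add: h)
    have deg: "degree g = degree P + degree h"
      unfolding h by (rule degree_mult_eq) (use nz monic_irredD(4)[OF P(1)] in simp_all)
    then have "degree h < degree g" using monic_irredD(5)[OF P(1)] by simp
    from less.hyps[OF this nz] have IH: "card {P. monic_irred P \<and> P dvd h} \<le> degree h" .
    have "{Q. monic_irred Q \<and> Q dvd g} \<subseteq> insert P {Q. monic_irred Q \<and> Q dvd h}"
    proof
      fix Q assume "Q \<in> {Q. monic_irred Q \<and> Q dvd g}"
      then have Q: "monic_irred Q" "Q dvd P * h" by (simp_all add: h)
      then have "Q dvd P \<or> Q dvd h"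
        using prime_elem_dvd_mult_iff[OF monic_irredD(2)[OF Q(1)]] by blast
      then show "Q \<in> insert P {Q. monic_irred Q \<and> Q dvd h}"
        using monic_irred_dvd_imp_eq[OF Q(1) P(1)] Q(1) by blast
    qed
    then have "card {Q. monic_irred Q \<and> Q dvd g} \<le> card (insert P {Q. monic_irred Q \<and> Q dvd h})"
      using finite_monic_irred_divisors[OF nz] by (intro card_mono) auto
    also have "\<dots> \<le> Suc (card {Q. monic_irred Q \<and> Q dvd h})"
      by (rule card_insert_le_m1[of "Suc _", simplified]) simp_all
    finally show ?thesis using IH deg monic_irredD(5)[OF P(1)] by linarith
  qed
qed

lemma frobenius_surj: "\<exists>y. y ^ CHAR('a) = (x :: 'a::finite_field)"
proof -
  have "inj (\<lambda>y :: 'a. y ^ CHAR('a))"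
  proof (rule injI)
    fix y z :: 'a assume yz: "y ^ CHAR('a) = z ^ CHAR('a)"
    have "((y - z) + z) ^ CHAR('a) = (y - z) ^ CHAR('a) + z ^ CHAR('a)"
      by (rule freshmans_dream) simp_all
    with yz have "(y - z) ^ CHAR('a) = 0" by simp
    then show "y = z" by simp
  qed
  then have "surj (\<lambda>y :: 'a. y ^ CHAR('a))" by (rule finite_UNIV_inj_surj[OF finite])
  then show ?thesis by (metis surjD)
qed

text \<open>
  A linear combination of powers of \<open>t ^ p\<close> is the \<open>p\<close>-th power of a combination of the same
  powers of \<open>t\<close>. So a prime of degree at least \<open>D\<close> other than \<open>t\<close> does not divide a nontrivial
  combination of \<open>D\<close> consecutive powers of \<open>t ^ p\<close>.
\<close>

lemma frobenius_powers_independent: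
  fixes P :: "'a::finite_field poly"
  assumes P: "monic_irred P" "poly P 0 \<noteq> 0" "D \<le> degree P"
    and dvd: "P dvd (\<Sum>j\<in>{1..D}. monom (\<delta> j) (CHAR('a) * j))"
    and j: "j \<in> {1..D}"
  shows "\<delta> j = 0"
proof -
  define \<eta> where "\<eta> = (\<lambda>j. SOME y. y ^ CHAR('a) = \<delta> j)"
  have \<eta>: "\<eta> j ^ CHAR('a) = \<delta> j" for j
    unfolding \<eta>_def by (rule someI_ex[OF frobenius_surj])
  define g where "g = (\<Sum>j\<in>{1..D}. monom (\<eta> j) j)"
  define g' where "g' = (\<Sum>j<D. monom (\<eta> (Suc j)) j)"
  note prime = monic_irredD(2)[OF P(1)]
  have "g ^ CHAR('a) = (\<Sum>j\<in>{1..D}. monom (\<eta> j) j ^ CHAR('a))"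
    unfolding g_def by (rule freshmans_dream_sum) simp_all
  also have "\<dots> = (\<Sum>j\<in>{1..D}. monom (\<delta> j) (CHAR('a) * j))"
    by (simp add: monom_power \<eta> mult.commute)
  finally have "P dvd g" using dvd prime_elem_dvd_power[OF prime] by metis
  moreover have "g = monom 1 1 * g'"
  proof -
    have "g = (\<Sum>j<D. monom (\<eta> (Suc j)) (Suc j))"
      unfolding g_def by (rule sum.reindex_bij_witness[of _ Suc "\<lambda>j. j - 1"]) auto
    then show ?thesis by (simp add: g'_def sum_distrib_left mult_monom)
  qed
  ultimately have "P dvd monom 1 1 \<or> P dvd g'"
    using prime_elem_dvd_mult_iff[OF prime] by metis
  moreover have "\<not> P dvd monom 1 1"
  proof
    assume "P dvd monom 1 1"
    then obtain h where h: "monom 1 1 = P * h" by (elim dvdE)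
    have hnz: "h \<noteq> 0" using h by (metis monom_eq_0_iff mult_zero_right one_neq_zero)
    have "degree (monom (1::'a) 1) = degree P + degree h"
      unfolding h by (rule degree_mult_eq) (use hnz monic_irredD(4)[OF P(1)] in simp_all)
    then have "degree h = 0" using monic_irredD(5)[OF P(1)] by (simp add: degree_monom_eq)
    moreover have "poly P 0 * poly h 0 = 0"
      using arg_cong[OF h, of "\<lambda>f. poly f 0"] by (simp add: poly_monom)
    ultimately show False using hnz P(2) by (auto elim!: degree_eq_zeroE)
  qed
  ultimately have "P dvd g'" by blast
  have "g' = 0"
  proof (rule ccontr)
    assume "g' \<noteq> 0"
    then have "degree P \<le> degree g'" using \<open>P dvd g'\<close> by (intro dvd_imp_degree_le)
    moreover have "degree g' < D"
    proof -
      have "coeff g' i = 0" if "i \<ge> D" for i using that by (auto simp: g'_def coeff_sum coeff_monom)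
      then show ?thesis using \<open>g' \<noteq> 0\<close> by (metis leading_coeff_0_iff not_less)
    qed
    ultimately show False using P(3) by simp
  qed
  moreover have "coeff g' (j - 1) = \<eta> j"
    using j by (auto simp: g'_def coeff_sum coeff_monom)
  ultimately have "\<eta> j = 0" by simp
  then show ?thesis using \<eta>[of j] by (simp add: power_0_left)
qed

lemma prob_Pi_pmf_fixed_coords:
  assumes "finite A" "J \<subseteq> A"
  shows "measure_pmf.prob (Pi_pmf A d p) {y. \<forall>j\<in>J. y j = v j} = (\<Prod>j\<in>J. pmf (p j) (v j))"
proof -
  let ?B = "\<lambda>j. if j \<in> J then {v j} else UNIV"
  have "{y. \<forall>j\<in>J. y j = v j} = Pi A ?B" using assms(2) by (fastforce simp: Pi_def)
  then have "measure_pmf.prob (Pi_pmf A d p) {y. \<forall>j\<in>J. y j = v j} =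
             (\<Prod>j\<in>A. measure_pmf.prob (p j) (?B j))"
    by (simp only: measure_Pi_pmf_Pi[OF assms(1)])
  also have "\<dots> = (\<Prod>j\<in>J. pmf (p j) (v j))"
    using assms by (intro prod.mono_neutral_cong_right) (auto simp: measure_pmf_single)
  finally show ?thesis .
qed

lemma prob_Pi_pmf_fixed_coords_le:
  assumes "finite A" "J \<subseteq> A" "\<And>j x. j \<in> J \<Longrightarrow> pmf (p j) x \<le> \<rho>"
  shows "measure_pmf.prob (Pi_pmf A d p) {y. \<forall>j\<in>J. y j = v j} \<le> \<rho> ^ card J"
proof -
  have "(\<Prod>j\<in>J. pmf (p j) (v j)) \<le> (\<Prod>j\<in>J. \<rho>)"
    by (intro prod_mono) (use assms in auto)
  also have "\<dots> = \<rho> ^ card J" by simp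
  finally show ?thesis by (subst prob_Pi_pmf_fixed_coords[OF assms(1,2)])
qed

lemma prob_pair_pmf_le:
  assumes "\<And>x. measure_pmf.prob M2 {y. (x, y) \<in> E} \<le> b"
  shows "measure_pmf.prob (pair_pmf M1 M2) E \<le> b"
proof -
  have b: "b \<ge> 0" using assms measure_nonneg order_trans by blast
  have "emeasure (pair_pmf M1 M2) E = (\<integral>\<^sup>+z. indicator E z \<partial>pair_pmf M1 M2)" by simp
  also have "\<dots> = (\<integral>\<^sup>+x. \<integral>\<^sup>+y. indicator E (x, y) \<partial>M2 \<partial>M1)" by (rule nn_integral_pair_pmf')
  also have "\<dots> \<le> (\<integral>\<^sup>+x. ennreal b \<partial>M1)"
  proof (rule nn_integral_mono)
    fix x
    have "(\<integral>\<^sup>+y. indicator E (x, y) \<partial>M2) = (\<integral>\<^sup>+y. indicator {y. (x, y) \<in> E} y \<partial>M2)"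
      by (intro nn_integral_cong) (auto simp: indicator_def)
    also have "\<dots> = ennreal (measure_pmf.prob M2 {y. (x, y) \<in> E})"
      by (simp add: measure_pmf.emeasure_eq_measure)
    also have "\<dots> \<le> ennreal b" by (intro ennreal_leI assms)
    finally show "(\<integral>\<^sup>+y. indicator E (x, y) \<partial>M2) \<le> ennreal b" .
  qed
  also have "\<dots> = ennreal b" by (simp add: measure_pmf.emeasure_space_1)
  finally show ?thesis using b by (simp add: measure_pmf.emeasure_eq_measure)
qed

text \<open>
  If \<open>P ^ 2\<close> divides \<open>f\<close>, then \<open>P\<close> divides both \<open>f\<close> and its derivative. The coefficients at the exponents
  \<open>p, 2 * p, \<dots>, D * p\<close> do not influence the derivative. Once all others are given, the derivative
  is therefore fixed. If it is nonzero, it leaves at most \<open>n\<close> candidates for \<open>P\<close>, each of which divides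
  \<open>f\<close> for at most one choice of these \<open>D\<close> coefficients. If it is zero, then so are \<open>D\<close> coefficients
  at exponents congruent to \<open>1\<close> modulo \<open>p\<close>. In both cases, \<open>D\<close> independent coefficients
  take prescribed values. All exponents used are at least \<open>2\<close>, where \<open>\<rho>\<close> bounds the atoms.
\<close>

lemma prob_large_square_le:
  fixes \<mu> :: "nat \<Rightarrow> 'a::finite_field pmf"
  assumes \<rho>: "\<And>i x. 2 \<le> i \<Longrightarrow> i < n \<Longrightarrow> pmf (\<mu> i) x \<le> \<rho>"
    and n: "CHAR('a) * D + 1 < n"
  shows "measure_pmf.prob (Pi_pmf {..<n} 0 \<mu>)
           {\<epsilon>. \<exists>P. monic_irred P \<and> poly P 0 \<noteq> 0 \<and> D \<le> degree P \<and> P\<^sup>2 dvd monic_poly n \<epsilon>}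
         \<le> (real n + 1) * \<rho> ^ D"
proof -
  define p where "p = CHAR('a)"
  have p: "p \<ge> 2" unfolding p_def by (intro prime_ge_2_nat) simp
  define \<Omega> where "\<Omega> = Pi_pmf {..<n} 0 \<mu>"
  have \<rho>0: "\<rho> ^ D \<ge> 0"
  proof (cases D)
    case (Suc d)
    then have "2 < n" using n p by (simp add: p_def)
    then have "0 \<le> \<rho>" using \<rho>[of 2 0] pmf_nonneg[of "\<mu> 2" 0] by linarith
    then show ?thesis by simp
  qed simp
  define E where "E = {\<epsilon> :: nat \<Rightarrow> 'a. \<exists>P. monic_irred P \<and> poly P 0 \<noteq> 0 \<and> D \<le> degree P \<and> P\<^sup>2 dvd monic_poly n \<epsilon>}"
  define E0 where "E0 = {\<epsilon> :: nat \<Rightarrow> 'a. pderiv (monic_poly n \<epsilon>) = 0}"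
  define E1 where "E1 = {\<epsilon> :: nat \<Rightarrow> 'a. pderiv (monic_poly n \<epsilon>) \<noteq> 0 \<and> (\<exists>P. monic_irred P \<and> poly P 0 \<noteq> 0 \<and>
                      D \<le> degree P \<and> P dvd pderiv (monic_poly n \<epsilon>) \<and> P dvd monic_poly n \<epsilon>)}"
  have "E \<subseteq> E0 \<union> E1"
  proof
    fix \<epsilon> assume "\<epsilon> \<in> E"
    then obtain P where P: "monic_irred P" "poly P 0 \<noteq> 0" "D \<le> degree P" "P\<^sup>2 dvd monic_poly n \<epsilon>"
      by (auto simp: E_def)
    from P(4) obtain h where "monic_poly n \<epsilon> = P\<^sup>2 * h" by (elim dvdE)
    then have h: "monic_poly n \<epsilon> = P * (P * h)" by (simp only: power2_eq_square mult.assoc)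
    have "P dvd pderiv (monic_poly n \<epsilon>)" unfolding h pderiv_mult by (intro dvd_add) simp_all
    moreover have "P dvd monic_poly n \<epsilon>" unfolding h by (rule dvd_triv_left)
    ultimately show "\<epsilon> \<in> E0 \<union> E1" using P(1-3) by (auto simp: E0_def E1_def)
  qed
  have E0: "measure_pmf.prob \<Omega> E0 \<le> \<rho> ^ D"
  proof -
    define J where "J = (\<lambda>j. p * j + 1) ` {1..D}"
    have cardJ: "card J = D" unfolding J_def using p by (subst card_image) (auto intro!: inj_onI)
    have J: "2 \<le> i \<and> i < n" if i: "i \<in> J" for i
    proof -
      from i obtain j where "j \<in> {1..D}" and i_eq: "i = p * j + 1" unfolding J_def by blast
      then have j: "1 \<le> j" "j \<le> D" by auto
      have "p * j \<le> p * D" using j by simp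
      moreover have "p * 1 \<le> p * j" using j by (intro mult_le_mono2)
      ultimately show ?thesis using n p unfolding i_eq p_def by linarith
    qed
    have "E0 \<subseteq> {\<epsilon>. \<forall>i\<in>J. \<epsilon> i = 0}"
    proof (intro subsetI CollectI ballI)
      fix \<epsilon> i assume \<epsilon>: "\<epsilon> \<in> E0" and i: "i \<in> J"
      from i obtain j where "i = p * j + 1" unfolding J_def by blast
      then have j: "i = Suc (p * j)" by simp
      have one: "of_nat (Suc (p * j)) = (1 :: 'a)" by (simp add: p_def)
      have "coeff (pderiv (monic_poly n \<epsilon>)) (p * j) = of_nat (Suc (p * j)) * coeff (monic_poly n \<epsilon>) i"
        unfolding j by (rule coeff_pderiv)
      also have "\<dots> = \<epsilon> i" using J[OF i] unfolding one by (simp add: coeff_monic_poly)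
      finally show "\<epsilon> i = 0" using \<epsilon> by (simp add: E0_def)
    qed
    then have "measure_pmf.prob \<Omega> E0 \<le> measure_pmf.prob \<Omega> {\<epsilon>. \<forall>i\<in>J. \<epsilon> i = 0}"
      by (intro measure_pmf.finite_measure_mono) auto
    also have "\<dots> \<le> \<rho> ^ card J" unfolding \<Omega>_def
      by (rule prob_Pi_pmf_fixed_coords_le) (use J \<rho> in auto)
    finally show ?thesis by (simp add: cardJ)
  qed
  have E1: "measure_pmf.prob \<Omega> E1 \<le> real n * \<rho> ^ D"
  proof -
    define J where "J = (\<lambda>j. p * j) ` {1..D}"
    define A where "A = {..<n} - J"
    have injJ: "inj_on (\<lambda>j. p * j) {1..D}" using p by (auto intro!: inj_onI)
    have cardJ: "card J = D" unfolding J_def card_image[OF injJ] by simp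
    have J: "2 \<le> i \<and> i < n" if i: "i \<in> J" for i
    proof -
      from i obtain j where "j \<in> {1..D}" and i_eq: "i = p * j" unfolding J_def by blast
      then have j: "1 \<le> j" "j \<le> D" by auto
      have "p * j \<le> p * D" using j by simp
      moreover have "p * 1 \<le> p * j" using j by (intro mult_le_mono2)
      ultimately show ?thesis using n p unfolding i_eq p_def by linarith
    qed
    have finJ: "finite J" "finite A" by (auto simp: J_def A_def)
    have AJ: "A \<inter> J = {}" "{..<n} = A \<union> J" using J by (auto simp: A_def)
    define merge where "merge = (\<lambda>x y :: nat \<Rightarrow> 'a. \<lambda>i. if i \<in> A then x i else y i)"
    have "\<Omega> = map_pmf (\<lambda>(x, y). merge x y) (pair_pmf (Pi_pmf A 0 \<mu>) (Pi_pmf J 0 \<mu>))"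
      unfolding \<Omega>_def AJ(2) merge_def by (rule Pi_pmf_union[OF finJ(2,1) AJ(1)])
    then have "measure_pmf.prob \<Omega> E1 =
       measure_pmf.prob (pair_pmf (Pi_pmf A 0 \<mu>) (Pi_pmf J 0 \<mu>)) {(x, y). merge x y \<in> E1}"
      by (simp add: vimage_def case_prod_unfold)
    also have "\<dots> \<le> real n * \<rho> ^ D"
    proof (rule prob_pair_pmf_le)
      fix x :: "nat \<Rightarrow> 'a"
      define \<beta> where "\<beta> = (\<lambda>i. if i \<in> A then x i else 0)"
      define g where "g = pderiv (monic_poly n \<beta>)"
      have expand: "monic_poly n (merge x y) =
          monic_poly n \<beta> + (\<Sum>j\<in>{1..D}. monom (y (p * j)) (p * j))" for y
      proof -
        have "(\<Sum>i<n. monom (merge x y i) i) =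
              (\<Sum>i\<in>A. monom (merge x y i) i) + (\<Sum>i\<in>J. monom (merge x y i) i)"
          unfolding AJ(2) by (rule sum.union_disjoint) (use finJ AJ in auto)
        also have "(\<Sum>i\<in>A. monom (merge x y i) i) = (\<Sum>i<n. monom (\<beta> i) i)"
          by (intro sum.mono_neutral_cong_left) (auto simp: merge_def \<beta>_def A_def)
        also have "(\<Sum>i\<in>J. monom (merge x y i) i) = (\<Sum>i\<in>J. monom (y i) i)"
          using AJ(1) by (intro sum.cong refl) (auto simp: merge_def)
        also have "\<dots> = (\<Sum>j\<in>{1..D}. monom (y (p * j)) (p * j))"
          unfolding J_def by (subst sum.reindex[OF injJ]) simp
        finally show ?thesis by (simp add: monic_poly_def)
      qed
      have deriv: "pderiv (monic_poly n (merge x y)) = g" for y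
      proof -
        have "pderiv (\<Sum>j\<in>S. monom (y (p * j)) (p * j)) = 0" for S
          by (induction S rule: infinite_finite_induct) (simp_all add: pderiv_add pderiv_monom p_def)
        then show ?thesis by (simp add: expand pderiv_add g_def)
      qed
      define B where "B = {P. monic_irred P \<and> P dvd g \<and> poly P 0 \<noteq> 0 \<and> D \<le> degree P}"
      show "measure_pmf.prob (Pi_pmf J 0 \<mu>) {y. (x, y) \<in> {(x, y). merge x y \<in> E1}} \<le> real n * \<rho> ^ D"
      proof (cases "g = 0")
        case True
        then have "{y. (x, y) \<in> {(x, y). merge x y \<in> E1}} = {}" by (simp add: E1_def deriv)
        then show ?thesis using \<rho>0 by simp
      next
        case False
        have finB: "finite B"
          by (rule finite_subset[OF _ finite_monic_irred_divisors[OF False]]) (auto simp: B_def)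
        have "card B \<le> card {P. monic_irred P \<and> P dvd g}"
          by (rule card_mono[OF finite_monic_irred_divisors[OF False]]) (auto simp: B_def)
        also have "\<dots> \<le> degree g" by (rule card_monic_irred_divisors_le_degree[OF False])
        also have "\<dots> \<le> n" unfolding g_def
          by (intro degree_le) (simp add: coeff_pderiv coeff_monic_poly)
        finally have cardB: "card B \<le> n" .
        have each: "measure_pmf.prob (Pi_pmf J 0 \<mu>) {y. P dvd monic_poly n (merge x y)} \<le> \<rho> ^ D"
          if P: "P \<in> B" for P
        proof (cases "\<exists>y0. P dvd monic_poly n (merge x y0)")
          case False
          then show ?thesis using \<rho>0 by simp
        next
          case True
          then obtain y0 where y0: "P dvd monic_poly n (merge x y0)" by blast
          have "{y. P dvd monic_poly n (merge x y)} \<subseteq> {y. \<forall>i\<in>J. y i = y0 i}"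
          proof (intro subsetI CollectI ballI)
            fix y i assume "y \<in> {y. P dvd monic_poly n (merge x y)}" and i: "i \<in> J"
            then have "P dvd monic_poly n (merge x y) - monic_poly n (merge x y0)"
              using y0 by (intro dvd_diff) auto
            also have "monic_poly n (merge x y) - monic_poly n (merge x y0) =
                (\<Sum>j\<in>{1..D}. monom (y (p * j) - y0 (p * j)) (p * j))"
              by (simp add: expand sum_subtractf flip: diff_monom)
            finally have "y (p * j) - y0 (p * j) = 0" if "j \<in> {1..D}" for j
              using frobenius_powers_independent[of P D "\<lambda>j. y (p * j) - y0 (p * j)" j] P that
              by (simp add: B_def p_def)
            with i show "y i = y0 i" by (auto simp: J_def)
          qed
          then have "measure_pmf.prob (Pi_pmf J 0 \<mu>) {y. P dvd monic_poly n (merge x y)} \<le>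
                measure_pmf.prob (Pi_pmf J 0 \<mu>) {y. \<forall>i\<in>J. y i = y0 i}"
            by (intro measure_pmf.finite_measure_mono) auto
          also have "\<dots> \<le> \<rho> ^ card J"
            by (rule prob_Pi_pmf_fixed_coords_le) (use J \<rho> finJ in auto)
          finally show ?thesis by (simp add: cardJ)
        qed
        have "{y. (x, y) \<in> {(x, y). merge x y \<in> E1}} \<subseteq> (\<Union>P\<in>B. {y. P dvd monic_poly n (merge x y)})"
          by (auto simp: E1_def deriv B_def)
        then have "measure_pmf.prob (Pi_pmf J 0 \<mu>) {y. (x, y) \<in> {(x, y). merge x y \<in> E1}} \<le>
            measure_pmf.prob (Pi_pmf J 0 \<mu>) (\<Union>P\<in>B. {y. P dvd monic_poly n (merge x y)})"
          by (intro measure_pmf.finite_measure_mono) auto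
        also have "\<dots> \<le> (\<Sum>P\<in>B. measure_pmf.prob (Pi_pmf J 0 \<mu>) {y. P dvd monic_poly n (merge x y)})"
          by (rule measure_pmf.finite_measure_subadditive_finite[OF finB]) auto
        also have "\<dots> \<le> (\<Sum>P\<in>B. \<rho> ^ D)" by (intro sum_mono each)
        also have "\<dots> \<le> real n * \<rho> ^ D" using cardB \<rho>0 by (simp add: mult_right_mono)
        finally show ?thesis .
      qed
    qed
    finally show ?thesis .
  qed
  have "measure_pmf.prob \<Omega> E \<le> measure_pmf.prob \<Omega> (E0 \<union> E1)"
    using \<open>E \<subseteq> E0 \<union> E1\<close> by (intro measure_pmf.finite_measure_mono) auto
  also have "\<dots> \<le> measure_pmf.prob \<Omega> E0 + measure_pmf.prob \<Omega> E1"
    by (rule measure_Un_le) auto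
  also have "\<dots> \<le> (real n + 1) * \<rho> ^ D" using E0 E1 by (simp add: algebra_simps)
  finally show ?thesis unfolding \<Omega>_def E_def .
qed

section \<open>The density of polynomials without square factors prime to \<open>t\<close>\<close>

lemma card_field_ge_2: "real CARD('a::finite_field) \<ge> 2"
proof -
  have "card {0, 1 :: 'a} \<le> CARD('a)" by (intro card_mono) auto
  then show ?thesis by simp
qed

lemma sum_geometric_tail_le:
  fixes x :: real
  assumes "0 \<le> x" "x \<le> 1 / 2"
  shows "(\<Sum>d\<in>{l..k}. x ^ d) \<le> 2 * x ^ l"
proof (cases "l \<le> k")
  case True
  \<comment> \<open>Subtracting \<open>x ^ k\<close> makes the bound inductive in \<open>k\<close>.\<close>
  then have "(\<Sum>d\<in>{l..k}. x ^ d) \<le> 2 * x ^ l - x ^ k"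
  proof (induction k rule: dec_induct)
    case (step k)
    have "2 * x ^ Suc k \<le> x ^ k" using assms mult_right_mono[of "2 * x" 1 "x ^ k"] by simp
    with step show ?case by (simp add: atLeastAtMostSuc_conv)
  qed simp
  moreover have "0 \<le> x ^ k" using assms by simp
  ultimately show ?thesis by linarith
qed (use assms in simp)

lemma sum_monic_inverse_square_le:
  fixes S :: "'a::finite_field poly set"
  assumes "\<And>m. m \<in> S \<Longrightarrow> lead_coeff m = 1 \<and> l \<le> degree m \<and> degree m \<le> k"
  shows "(\<Sum>m\<in>S. 1 / real CARD('a) ^ (2 * degree m)) \<le> 2 / real CARD('a) ^ l"
proof -
  define q where "q = real CARD('a)"
  have q: "q \<ge> 2" unfolding q_def by (rule card_field_ge_2)
  have "(\<Sum>m\<in>S. 1 / q ^ (2 * degree m)) \<le>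
        (\<Sum>m\<in>(\<Union>d\<in>{l..k}. monics d). 1 / q ^ (2 * degree (m :: 'a poly)))"
  proof (rule sum_mono2)
    show "S \<subseteq> (\<Union>d\<in>{l..k}. monics d)" using assms by (auto simp: monics_def)
  qed (use q in simp_all)
  also have "\<dots> = (\<Sum>d\<in>{l..k}. \<Sum>m\<in>monics d. 1 / q ^ (2 * degree (m :: 'a poly)))"
    by (rule sum.UNION_disjoint) (simp_all add: monics_disjoint)
  also have "\<dots> = (\<Sum>d\<in>{l..k}. \<Sum>m\<in>(monics d :: 'a poly set). 1 / q ^ (2 * d))"
    by (intro sum.cong refl) (simp add: monics_def)
  also have "\<dots> = (\<Sum>d\<in>{l..k}. (1 / q) ^ d)"
    using q by (simp add: card_monics q_def[symmetric] mult_2 power_add power_divide)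
  also have "\<dots> \<le> 2 * (1 / q) ^ l" using q by (intro sum_geometric_tail_le) auto
  finally show ?thesis by (simp add: q_def power_divide)
qed

lemma card_monic_degree_le:
  fixes S :: "'a::finite_field poly set"
  assumes "\<And>m. m \<in> S \<Longrightarrow> lead_coeff m = 1 \<and> degree m \<le> k"
  shows "real (card S) \<le> real CARD('a) ^ (k + 1)"
proof -
  have "S \<subseteq> (\<Union>d\<in>{..k}. monics d)" using assms by (auto simp: monics_def)
  then have "card S \<le> card (\<Union>d\<in>{..k}. monics d :: 'a poly set)" by (intro card_mono) auto
  also have "\<dots> \<le> (\<Sum>d\<in>{..k}. card (monics d :: 'a poly set))" by (rule card_UN_le) simp
  also have "\<dots> = (\<Sum>d\<in>{..k}. CARD('a) ^ d)" by (simp add: card_monics)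
  also have "\<dots> \<le> CARD('a) ^ (k + 1)"
  proof (induction k)
    case (Suc k)
    have "2 * CARD('a) ^ (k + 1) \<le> CARD('a) * CARD('a) ^ (k + 1)"
      using card_field_ge_2[where 'a = 'a] by (intro mult_right_mono) simp_all
    also have "\<dots> = CARD('a) ^ (Suc k + 1)" by simp
    finally have "2 * CARD('a) ^ (k + 1) \<le> CARD('a) ^ (Suc k + 1)" .
    moreover have "(\<Sum>d\<in>{..Suc k}. CARD('a) ^ d) = (\<Sum>d\<in>{..k}. CARD('a) ^ d) + CARD('a) ^ (k + 1)"
      by simp
    ultimately show ?case using Suc by linarith
  qed (use card_field_ge_2[where 'a = 'a] in simp)
  finally show ?thesis by (metis of_nat_le_iff of_nat_power)
qed

text \<open>
  Without the restriction to primes of degree less than \<open>D\<close>, the sum is a partial sum of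
  \<open>(1 - q X) / (1 - X)\<close> at \<open>X = 1 / q ^ 2\<close>; the restriction affects only \<open>m\<close> of degree at least \<open>D\<close>.
\<close>

lemma sieve_main_term:
  "\<bar>(\<Sum>m | m \<in> smooth_squarefree D \<and> degree m \<le> k. mob (m :: 'a::finite_field poly) / real CARD('a) ^ (2 * degree m))
      - real CARD('a) / (real CARD('a) + 1)\<bar> \<le> 2 / real CARD('a) ^ D + 1 / real CARD('a) ^ k"
proof -
  define q where "q = real CARD('a)"
  have q: "q \<ge> 2" unfolding q_def by (rule card_field_ge_2)
  define h where "h = (\<lambda>m :: 'a poly. mob m / q ^ (2 * degree m))"
  define T where "T = (\<lambda>d. {m \<in> monics d. poly (m :: 'a poly) 0 \<noteq> 0})"
  define S where "S = {m \<in> smooth_squarefree D. degree (m :: 'a poly) \<le> k}"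
  have finT: "finite (\<Union>d\<in>{..k}. T d)" by (auto simp: T_def)
  have sub: "S \<subseteq> (\<Union>d\<in>{..k}. T d)"
    by (auto simp: S_def T_def smooth_squarefree_def monics_def)
  have "sum h (\<Union>d\<in>{..k}. T d) = (\<Sum>d\<in>{..k}. sum h (T d))"
    by (rule sum.UNION_disjoint) (use monics_disjoint in \<open>auto simp: T_def\<close>)
  also have "\<dots> = (\<Sum>d\<in>{..k}. (if d = 0 then 1 else 1 - q) / q ^ (2 * d))"
  proof (intro sum.cong refl)
    fix d
    have "sum h (T d) = (\<Sum>m\<in>T d. mob m) / q ^ (2 * d)"
      unfolding sum_divide_distrib by (intro sum.cong refl) (simp add: h_def T_def monics_def)
    then show "sum h (T d) = (if d = 0 then 1 else 1 - q) / q ^ (2 * d)"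
      unfolding T_def q_def sum_mob_monics .
  qed
  also have "\<dots> = q / (q + 1) + 1 / ((q + 1) * q ^ (2 * k))"
  proof (induction k)
    case 0
    then show ?case using q by (simp add: field_simps)
  next
    case (Suc k)
    define y where "y = q ^ (2 * k)"
    have y: "y > 0" using q by (simp add: y_def)
    have pw: "q ^ (2 * Suc k) = y * q\<^sup>2" by (simp add: y_def power2_eq_square)
    have combine: "1 / (s * y) + (1 - q) / (y * q\<^sup>2) = (q\<^sup>2 + (1 - q) * s) / (s * (y * q\<^sup>2))"
      if "s > 0" for s
      using that q y by (simp add: field_simps)
    have "q\<^sup>2 + (1 - q) * (q + 1) = 1" by (simp add: algebra_simps power2_eq_square)
    then have step: "1 / ((q + 1) * y) + (1 - q) / (y * q\<^sup>2) = 1 / ((q + 1) * (y * q\<^sup>2))"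
      using combine[of "q + 1"] q by simp
    have "(\<Sum>d\<in>{..Suc k}. (if d = 0 then 1 else 1 - q) / q ^ (2 * d)) =
          (\<Sum>d\<in>{..k}. (if d = 0 then 1 else 1 - q) / q ^ (2 * d)) + (1 - q) / q ^ (2 * Suc k)"
      by simp
    also have "\<dots> = q / (q + 1) + (1 / ((q + 1) * y) + (1 - q) / (y * q\<^sup>2))"
      unfolding Suc.IH pw y_def by (rule add.assoc)
    finally show ?case unfolding step pw .
  qed
  finally have full: "sum h (\<Union>d\<in>{..k}. T d) = q / (q + 1) + 1 / ((q + 1) * q ^ (2 * k))" .
  have tail: "\<bar>1 / ((q + 1) * q ^ (2 * k))\<bar> \<le> 1 / q ^ k"
  proof -
    have "1 * q ^ k \<le> (q + 1) * q ^ (2 * k)"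
      using q by (intro mult_mono power_increasing) auto
    then show ?thesis using q by (simp add: frac_le)
  qed
  define R where "R = {m \<in> (\<Union>d\<in>{..k}. T d) - S. squarefree m}"
  have "sum h ((\<Union>d\<in>{..k}. T d) - S) = sum h R"
    using finT by (intro sum.mono_neutral_right) (auto simp: R_def h_def mob_def)
  also have "\<bar>\<dots>\<bar> \<le> (\<Sum>m\<in>R. 1 / q ^ (2 * degree m))"
  proof (rule order_trans[OF sum_abs sum_mono])
    fix m :: "'a poly"
    show "\<bar>h m\<bar> \<le> 1 / q ^ (2 * degree m)"
      using q abs_mob_le_1[of m] by (simp add: h_def divide_right_mono)
  qed
  also have "\<dots> \<le> 2 / q ^ D"
    unfolding q_def
  proof (rule sum_monic_inverse_square_le)
    fix m assume m: "m \<in> R"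
    then have m': "lead_coeff m = 1" "degree m \<le> k" "poly m 0 \<noteq> 0" "squarefree m" "m \<notin> smooth_squarefree D"
      by (auto simp: R_def T_def S_def monics_def)
    then obtain P where P: "monic_irred P" "P dvd m" "\<not> degree P < D"
      by (auto simp: smooth_squarefree_def)
    have "m \<noteq> 0" using m'(3) by auto
    then have "degree P \<le> degree m" using P(2) by (intro dvd_imp_degree_le)
    then show "lead_coeff m = 1 \<and> D \<le> degree m \<and> degree m \<le> k" using m' P by simp
  qed
  finally have diff: "\<bar>sum h ((\<Union>d\<in>{..k}. T d) - S)\<bar> \<le> 2 / q ^ D" .
  have "sum h (\<Union>d\<in>{..k}. T d) = sum h ((\<Union>d\<in>{..k}. T d) - S) + sum h S"
    by (rule sum.subset_diff[OF sub finT])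
  with full tail diff have "\<bar>sum h S - q / (q + 1)\<bar> \<le> 2 / q ^ D + 1 / q ^ k" by linarith
  then show ?thesis by (simp add: S_def h_def q_def)
qed

text \<open>
  Take expectations in the truncated sieve and replace each probability that \<open>m ^ 2\<close> divides \<open>f\<close>
  by \<open>1 / q ^ (2 * degree m)\<close>, at the cost of the equidistribution error for each of the at most
  \<open>q ^ (k + 1)\<close> polynomials \<open>m\<close>. The sum that bounds the truncation error consists of \<open>m\<close> of degree
  exceeding \<open>k - D\<close>.
\<close>

lemma prob_no_square_below_approx:
  fixes \<mu> :: "nat \<Rightarrow> 'a::finite_field pmf"
  assumes F: "\<And>i \<alpha>. 2 \<le> i \<Longrightarrow> i < n \<Longrightarrow> \<alpha> \<noteq> 0 \<Longrightarrow> norm (fourier (\<mu> i) \<alpha>) \<le> c"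
    and c: "0 \<le> c" "c < 1" and n: "2 < n" and k: "D \<le> k"
  shows "\<bar>measure_pmf.prob (Pi_pmf {..<n} 0 \<mu>) {\<epsilon>. no_square_below D (monic_poly n \<epsilon>)}
            - real CARD('a) / (real CARD('a) + 1)\<bar>
         \<le> 2 * real CARD('a) ^ (k + 1) * c ^ ((n - 2) div (2 * k))
           + 2 / real CARD('a) ^ (k - D) + 2 / real CARD('a) ^ D + 1 / real CARD('a) ^ k"
proof -
  define q where "q = real CARD('a)"
  have q: "q \<ge> 2" unfolding q_def by (rule card_field_ge_2)
  define \<Omega> where "\<Omega> = Pi_pmf {..<n} 0 \<mu>"
  have fin: "finite (set_pmf \<Omega>)" unfolding \<Omega>_def by (rule finite_set_Pi_pmf) simp
  have int: "integrable (measure_pmf \<Omega>) f" for f :: "_ \<Rightarrow> real"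
    using fin by (rule integrable_measure_pmf_finite)
  have E_bool: "measure_pmf.expectation \<Omega> (\<lambda>\<epsilon>. of_bool (Q \<epsilon>)) = measure_pmf.prob \<Omega> {\<epsilon>. Q \<epsilon>}" for Q
  proof -
    have "(\<lambda>\<epsilon>. of_bool (Q \<epsilon>) :: real) = indicator {\<epsilon>. Q \<epsilon>}" by (auto simp: indicator_def fun_eq_iff)
    then show ?thesis by simp
  qed
  define M where "M = {m \<in> smooth_squarefree D. degree (m :: 'a poly) \<le> k}"
  define W where "W = {m \<in> smooth_squarefree D. degree (m :: 'a poly) \<le> k \<and> k < degree m + D}"
  have finM: "finite M" unfolding M_def by (rule finite_smooth_squarefree_le)
  have WM: "W \<subseteq> M" by (auto simp: W_def M_def)
  have finW: "finite W" by (rule finite_subset[OF WM finM])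
  define \<eta> where "\<eta> = c ^ ((n - 2) div (2 * k))"
  have \<eta>: "\<eta> \<ge> 0" using c by (simp add: \<eta>_def)
  define pr where "pr = (\<lambda>m. measure_pmf.prob \<Omega> {\<epsilon>. m\<^sup>2 dvd monic_poly n \<epsilon>})"
  define w where "w = (\<lambda>m :: 'a poly. 1 / q ^ (2 * degree m))"
  have approx: "\<bar>pr m - w m\<bar> \<le> \<eta>" if m: "m \<in> M" for m
  proof (cases "degree m = 0")
    case True
    \<comment> \<open>Here \<open>m = 1\<close>, and the estimate has no decay since \<open>c ^ (_ div 0) = 1\<close>.\<close>
    then have "m = 1" using m by (auto simp: M_def smooth_squarefree_def elim!: degree_eq_zeroE)
    then show ?thesis using \<eta> by (simp add: pr_def w_def)
  next
    case False
    have "coeff (m\<^sup>2) 0 \<noteq> 0"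
      using m by (simp add: M_def smooth_squarefree_def power2_eq_square flip: poly_0_coeff_0)
    from prob_dvd_monic_poly_approx[OF this F c n]
    have "\<bar>pr m - 1 / q ^ degree (m\<^sup>2)\<bar> \<le> c ^ ((n - 2) div degree (m\<^sup>2))"
      by (simp add: pr_def \<Omega>_def q_def)
    moreover have deg: "degree (m\<^sup>2) = 2 * degree m"
      using False by (intro degree_power_eq) auto
    moreover have "c ^ ((n - 2) div (2 * degree m)) \<le> \<eta>"
      unfolding \<eta>_def using c False m
      by (intro power_decreasing div_le_mono2) (auto simp: M_def)
    ultimately show ?thesis by (simp add: w_def)
  qed
  have cardM: "real (card M) \<le> q ^ (k + 1)"
    unfolding q_def by (rule card_monic_degree_le) (auto simp: M_def smooth_squarefree_def)
  have cardW: "real (card W) \<le> q ^ (k + 1)"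
    using card_mono[OF finM WM] cardM by linarith
  define dev where "dev = (\<lambda>\<epsilon>. of_bool (no_square_below D (monic_poly n \<epsilon>)) -
            (\<Sum>m\<in>M. mob m * of_bool (m\<^sup>2 dvd monic_poly n \<epsilon>)))"
  have "measure_pmf.expectation \<Omega> dev =
        measure_pmf.prob \<Omega> {\<epsilon>. no_square_below D (monic_poly n \<epsilon>)} - (\<Sum>m\<in>M. mob m * pr m)"
    by (simp add: int E_bool pr_def dev_def)
  then have "\<bar>measure_pmf.prob \<Omega> {\<epsilon>. no_square_below D (monic_poly n \<epsilon>)} - (\<Sum>m\<in>M. mob m * pr m)\<bar>
      \<le> measure_pmf.expectation \<Omega> (\<lambda>\<epsilon>. \<bar>dev \<epsilon>\<bar>)"
    using integral_abs_bound[of "measure_pmf \<Omega>" dev] by simp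
  also have "\<dots> \<le> measure_pmf.expectation \<Omega> (\<lambda>\<epsilon>. \<Sum>m\<in>W. of_bool (m\<^sup>2 dvd monic_poly n \<epsilon>))"
    unfolding dev_def M_def W_def by (intro integral_mono int truncated_sieve_error)
  also have "\<dots> = (\<Sum>m\<in>W. pr m)" by (simp add: int E_bool pr_def)
  finally have sieve: "\<bar>measure_pmf.prob \<Omega> {\<epsilon>. no_square_below D (monic_poly n \<epsilon>)} - (\<Sum>m\<in>M. mob m * pr m)\<bar>
      \<le> (\<Sum>m\<in>W. pr m)" .
  have "(\<Sum>m\<in>W. pr m) \<le> (\<Sum>m\<in>W. w m + \<eta>)"
  proof (rule sum_mono)
    fix m assume "m \<in> W"
    then show "pr m \<le> w m + \<eta>" using approx[of m] WM by auto
  qed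
  also have "\<dots> = (\<Sum>m\<in>W. w m) + real (card W) * \<eta>" by (simp add: sum.distrib)
  also have "(\<Sum>m\<in>W. w m) \<le> 2 / q ^ (k - D)"
    unfolding w_def q_def
    by (rule sum_monic_inverse_square_le[where k = k]) (auto simp: W_def smooth_squarefree_def)
  also have "real (card W) * \<eta> \<le> q ^ (k + 1) * \<eta>" by (rule mult_right_mono[OF cardW \<eta>])
  finally have W: "(\<Sum>m\<in>W. pr m) \<le> 2 / q ^ (k - D) + q ^ (k + 1) * \<eta>" by simp
  have "\<bar>(\<Sum>m\<in>M. mob m * pr m) - (\<Sum>m\<in>M. mob m * w m)\<bar> = \<bar>\<Sum>m\<in>M. mob m * (pr m - w m)\<bar>"
    by (simp add: sum_subtractf right_diff_distrib)
  also have "\<dots> \<le> (\<Sum>m\<in>M. 1 * \<eta>)"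
  proof (rule order_trans[OF sum_abs sum_mono])
    fix m assume "m \<in> M"
    then show "\<bar>mob m * (pr m - w m)\<bar> \<le> 1 * \<eta>"
      unfolding abs_mult by (intro mult_mono approx abs_mob_le_1) auto
  qed
  also have "\<dots> \<le> q ^ (k + 1) * \<eta>" using mult_right_mono[OF cardM \<eta>] by simp
  finally have M: "\<bar>(\<Sum>m\<in>M. mob m * pr m) - (\<Sum>m\<in>M. mob m * w m)\<bar> \<le> q ^ (k + 1) * \<eta>" .
  have "\<bar>(\<Sum>m\<in>M. mob m * w m) - q / (q + 1)\<bar> \<le> 2 / q ^ D + 1 / q ^ k"
    using sieve_main_term[where 'a = 'a, of D k] by (simp add: M_def w_def q_def)
  with sieve W M have "\<bar>measure_pmf.prob \<Omega> {\<epsilon>. no_square_below D (monic_poly n \<epsilon>)} - q / (q + 1)\<bar>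
      \<le> 2 * (q ^ (k + 1) * \<eta>) + 2 / q ^ (k - D) + 2 / q ^ D + 1 / q ^ k" by linarith
  then show ?thesis by (simp add: \<Omega>_def q_def \<eta>_def mult.assoc)
qed

definition no_square_off_t :: "'a::field poly \<Rightarrow> bool" where
  "no_square_off_t f \<longleftrightarrow> (\<forall>P. monic_irred P \<longrightarrow> poly P 0 \<noteq> 0 \<longrightarrow> \<not> P\<^sup>2 dvd f)"

text \<open>
  The terms account for the squares of primes of degree at least \<open>D\<close>, for the deviation from
  equidistribution modulo squares of degree up to \<open>4 * D\<close>, and for cutting off the Moebius sums at
  degree \<open>2 * D\<close> and their primes at degree \<open>D\<close>.
\<close>

definition sieve_error :: "real \<Rightarrow> real \<Rightarrow> nat \<Rightarrow> nat \<Rightarrow> real" where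
  "sieve_error q c D n = (real n + 1) * ((1 + c) / 2) ^ D
     + 2 * q ^ (2 * D + 1) * c ^ ((n - 2) div (4 * D)) + 5 / q ^ D"

lemma prob_no_square_off_t_approx:
  fixes \<mu> :: "nat \<Rightarrow> 'a::finite_field pmf"
  assumes F: "\<And>i \<alpha>. 2 \<le> i \<Longrightarrow> i < n \<Longrightarrow> \<alpha> \<noteq> 0 \<Longrightarrow> norm (fourier (\<mu> i) \<alpha>) \<le> c"
    and c: "0 \<le> c" "c < 1" and n: "2 < n" "CHAR('a) * D + 1 < n"
  shows "\<bar>measure_pmf.prob (Pi_pmf {..<n} 0 \<mu>) {\<epsilon>. no_square_off_t (monic_poly n \<epsilon>)}
            - real CARD('a) / (real CARD('a) + 1)\<bar> \<le> sieve_error (real CARD('a)) c D n"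
proof -
  define q where "q = real CARD('a)"
  have q: "q \<ge> 2" unfolding q_def by (rule card_field_ge_2)
  define \<Omega> where "\<Omega> = Pi_pmf {..<n} 0 \<mu>"
  define X where "X = {\<epsilon>. no_square_off_t (monic_poly n \<epsilon> :: 'a poly)}"
  define Y where "Y = {\<epsilon>. no_square_below D (monic_poly n \<epsilon> :: 'a poly)}"
  define Z where "Z = {\<epsilon>. \<exists>P. monic_irred P \<and> poly P 0 \<noteq> 0 \<and> D \<le> degree P \<and> P\<^sup>2 dvd (monic_poly n \<epsilon> :: 'a poly)}"
  have "X \<subseteq> Y" by (auto simp: X_def Y_def no_square_off_t_def no_square_below_def)
  have "Y \<subseteq> X \<union> Z"
  proof
    fix \<epsilon> assume Y: "\<epsilon> \<in> Y"
    show "\<epsilon> \<in> X \<union> Z"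
    proof (cases "\<epsilon> \<in> X")
      case False
      then obtain P where P: "monic_irred P" "poly P 0 \<noteq> 0" "P\<^sup>2 dvd monic_poly n \<epsilon>"
        by (auto simp: X_def no_square_off_t_def)
      with Y have "\<not> degree P < D" by (auto simp: Y_def no_square_below_def)
      with P show ?thesis by (auto simp: Z_def)
    qed simp
  qed
  have large: "measure_pmf.prob \<Omega> Z \<le> (real n + 1) * ((1 + c) / 2) ^ D"
    unfolding \<Omega>_def Z_def
  proof (rule prob_large_square_le[OF _ n(2)])
    fix i x assume "2 \<le> i" "i < n"
    then show "pmf (\<mu> i) x \<le> (1 + c) / 2" using F[of i 1] by (intro pmf_le_of_fourier_le[of _ 1]) auto
  qed
  have small: "\<bar>measure_pmf.prob \<Omega> Y - q / (q + 1)\<bar>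
         \<le> 2 * q ^ (2 * D + 1) * c ^ ((n - 2) div (2 * (2 * D)))
           + 2 / q ^ (2 * D - D) + 2 / q ^ D + 1 / q ^ (2 * D)"
    unfolding \<Omega>_def Y_def q_def
    by (rule prob_no_square_below_approx[OF F c n(1)]) auto
  have "measure_pmf.prob \<Omega> X \<le> measure_pmf.prob \<Omega> Y"
    using \<open>X \<subseteq> Y\<close> by (intro measure_pmf.finite_measure_mono) auto
  moreover have "measure_pmf.prob \<Omega> Y \<le> measure_pmf.prob \<Omega> X + measure_pmf.prob \<Omega> Z"
    using measure_pmf.finite_measure_mono[OF \<open>Y \<subseteq> X \<union> Z\<close>, of \<Omega>] measure_Un_le[of X \<Omega> Z] by simp
  moreover have "1 / q ^ (2 * D) \<le> 1 / q ^ D"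
    using q by (intro divide_left_mono power_increasing) auto
  ultimately have "\<bar>measure_pmf.prob \<Omega> X - q / (q + 1)\<bar> \<le> sieve_error q c D n"
    using large small unfolding sieve_error_def by simp
  then show ?thesis by (simp add: \<Omega>_def X_def q_def)
qed

section \<open>The probability of being squarefree\<close>

lemma t_square_dvd_monic_poly_iff:
  assumes "2 \<le> n"
  shows "(monom 1 1)\<^sup>2 dvd monic_poly n \<epsilon> \<longleftrightarrow> \<epsilon> 0 = 0 \<and> \<epsilon> 1 = 0"
proof -
  have "(monom 1 1)\<^sup>2 dvd monic_poly n \<epsilon> \<longleftrightarrow> (\<forall>k<2. coeff (monic_poly n \<epsilon>) k = 0)"
    by (simp add: monom_power monom_1_dvd_iff')
  also have "\<dots> \<longleftrightarrow> \<epsilon> 0 = 0 \<and> \<epsilon> 1 = 0"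
    using assms by (auto simp: coeff_monic_poly less_2_cases_iff)
  finally show ?thesis .
qed

lemma squarefree_iff_no_square_off_t:
  fixes f :: "'a::field poly"
  assumes "f \<noteq> 0"
  shows "squarefree f \<longleftrightarrow> no_square_off_t f \<and> \<not> (monom 1 1)\<^sup>2 dvd f"
proof
  assume f: "squarefree f"
  have "\<not> is_unit (monom (1::'a) 1)"
    by (simp add: is_unit_iff_degree degree_monom_eq)
  then have "\<not> (monom 1 1)\<^sup>2 dvd f" using squarefreeD[OF f] by blast
  moreover have "no_square_off_t f"
    using f squarefree_iff_monic_irred[OF assms] by (simp add: no_square_off_t_def)
  ultimately show "no_square_off_t f \<and> \<not> (monom 1 1)\<^sup>2 dvd f" by simp
next
  assume *: "no_square_off_t f \<and> \<not> (monom 1 1)\<^sup>2 dvd f"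
  have "\<not> P\<^sup>2 dvd f" if P: "monic_irred P" for P
  proof (cases "poly P 0 = 0")
    case True
    then have "monom 1 1 dvd P" by (simp add: monom_1_dvd_iff' flip: poly_0_coeff_0)
    then show ?thesis using * dvd_trans[OF dvd_power_same] by blast
  next
    case False
    then show ?thesis using * P by (simp add: no_square_off_t_def)
  qed
  then show "squarefree f" by (simp add: squarefree_iff_monic_irred[OF assms])
qed

text \<open>
  Conditioning on \<open>\<epsilon> 0 = \<epsilon> 1 = 0\<close> amounts to replacing \<open>\<mu> 0\<close> and \<open>\<mu> 1\<close> by point masses at \<open>0\<close>. This
  keeps the conditioned law within the reach of estimates that constrain \<open>\<mu> i\<close> for \<open>i \<ge> 2\<close> only.
\<close>

lemma prob_Pi_pmf_two_zero:
  fixes \<mu> :: "nat \<Rightarrow> 'a::zero pmf"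
  assumes n: "2 \<le> n"
  shows "measure_pmf.prob (Pi_pmf {..<n} 0 \<mu>) (S \<inter> {\<epsilon>. \<epsilon> 0 = 0 \<and> \<epsilon> 1 = 0}) =
         pmf (\<mu> 0) 0 * pmf (\<mu> 1) 0 *
           measure_pmf.prob (Pi_pmf {..<n} 0 (\<mu>(0 := return_pmf 0, 1 := return_pmf 0))) S"
proof -
  define \<nu> where "\<nu> = \<mu>(0 := return_pmf (0::'a), 1 := return_pmf 0)"
  define w where "w = pmf (\<mu> 0) 0 * pmf (\<mu> 1) 0"
  have split: "(\<Prod>i<n. g i) = g 0 * g 1 * (\<Prod>i\<in>{2..<n}. g i)" for g :: "nat \<Rightarrow> real"
  proof -
    have "{..<n} = insert 0 (insert 1 {2..<n})" using n by auto
    then show ?thesis by (simp add: mult.assoc)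
  qed
  have on: "pmf (Pi_pmf {..<n} 0 \<mu>) y = w * pmf (Pi_pmf {..<n} 0 \<nu>) y" if "y 0 = 0" "y 1 = 0" for y
  proof -
    have "(\<Prod>i\<in>{2..<n}. pmf (\<nu> i) (y i)) = (\<Prod>i\<in>{2..<n}. pmf (\<mu> i) (y i))"
      by (intro prod.cong) (auto simp: \<nu>_def)
    moreover have "pmf (\<nu> 0) 0 = 1" "pmf (\<nu> 1) 0 = 1" by (simp_all add: \<nu>_def)
    ultimately show ?thesis using that by (auto simp: pmf_Pi split w_def)
  qed
  have off: "pmf (Pi_pmf {..<n} 0 \<nu>) y = 0" if "\<not> (y 0 = 0 \<and> y 1 = 0)" for y
  proof -
    have "pmf (\<nu> 0) (y 0) * pmf (\<nu> 1) (y 1) = 0" using that by (auto simp: \<nu>_def indicator_def)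
    then show ?thesis by (simp add: pmf_Pi split)
  qed
  have "measure_pmf.prob (Pi_pmf {..<n} 0 \<mu>) (S \<inter> {\<epsilon>. \<epsilon> 0 = 0 \<and> \<epsilon> 1 = 0}) =
        infsetsum (pmf (Pi_pmf {..<n} 0 \<mu>)) (S \<inter> {\<epsilon>. \<epsilon> 0 = 0 \<and> \<epsilon> 1 = 0})"
    by (rule measure_pmf_conv_infsetsum)
  also have "\<dots> = infsetsum (\<lambda>y. w * pmf (Pi_pmf {..<n} 0 \<nu>) y) S"
    by (rule infsetsum_cong_neutral) (auto simp: on off)
  also have "\<dots> = w * infsetsum (pmf (Pi_pmf {..<n} 0 \<nu>)) S"
    by (intro infsetsum_cmult_right pmf_abs_summable)
  also have "infsetsum (pmf (Pi_pmf {..<n} 0 \<nu>)) S = measure_pmf.prob (Pi_pmf {..<n} 0 \<nu>) S"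
    by (rule measure_pmf_conv_infsetsum[symmetric])
  finally show ?thesis by (simp add: w_def \<nu>_def)
qed

lemma random_monic_poly_conv: "random_monic_poly \<mu> n = map_pmf (monic_poly n) (Pi_pmf {..<n} 0 \<mu>)"
  by (simp add: random_monic_poly_def monic_poly_def[abs_def])

lemma Lambda_eq:
  assumes "2 \<le> n"
  shows "Lambda \<mu> n = pmf (\<mu> 0) 0 * pmf (\<mu> 1) 0"
proof -
  have "Lambda \<mu> n = measure_pmf.prob (Pi_pmf {..<n} 0 \<mu>) (UNIV \<inter> {\<epsilon>. \<epsilon> 0 = 0 \<and> \<epsilon> 1 = 0})"
    unfolding Lambda_def random_monic_poly_conv
    by (simp add: vimage_def t_square_dvd_monic_poly_iff[OF assms, simplified])
  also have "\<dots> = pmf (\<mu> 0) 0 * pmf (\<mu> 1) 0"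
    unfolding prob_Pi_pmf_two_zero[OF assms] by simp
  finally show ?thesis .
qed

text \<open>
  From the event that no square of a prime other than \<open>t\<close> divides \<open>f\<close>, remove its intersection
  with \<open>\<epsilon> 0 = \<epsilon> 1 = 0\<close>. The same density estimate applies to both, before and after
  conditioning.
\<close>

lemma prob_squarefree_approx:
  fixes \<mu> :: "nat \<Rightarrow> 'a::finite_field pmf"
  assumes F: "\<And>i \<alpha>. 2 \<le> i \<Longrightarrow> i < n \<Longrightarrow> \<alpha> \<noteq> 0 \<Longrightarrow> norm (fourier (\<mu> i) \<alpha>) \<le> c"
    and c: "0 \<le> c" "c < 1" and n: "2 < n" "CHAR('a) * D + 1 < n"
  shows "\<bar>prob_squarefree \<mu> n - kappa \<mu>\<bar> \<le> 2 * sieve_error (real CARD('a)) c D n"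
proof -
  define q where "q = real CARD('a)"
  have q: "q \<ge> 2" unfolding q_def by (rule card_field_ge_2)
  define \<nu> where "\<nu> = \<mu>(0 := return_pmf (0::'a), 1 := return_pmf 0)"
  define w where "w = pmf (\<mu> 0) 0 * pmf (\<mu> 1) 0"
  have w: "0 \<le> w" "w \<le> 1" by (auto simp: w_def pmf_le_1 mult_le_one)
  define X where "X = {\<epsilon>. no_square_off_t (monic_poly n \<epsilon> :: 'a poly)}"
  define Z where "Z = {\<epsilon> :: nat \<Rightarrow> 'a. \<epsilon> 0 = 0 \<and> \<epsilon> 1 = 0}"
  define \<kappa> where "\<kappa> = q / (q + 1)"
  define a where "a = measure_pmf.prob (Pi_pmf {..<n} 0 \<mu>) X - \<kappa>"
  define b where "b = measure_pmf.prob (Pi_pmf {..<n} 0 \<nu>) X - \<kappa>"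
  have "prob_squarefree \<mu> n = measure_pmf.prob (Pi_pmf {..<n} 0 \<mu>) (X - (X \<inter> Z))"
  proof -
    have "{\<epsilon>. squarefree (monic_poly n \<epsilon> :: 'a poly)} = X - (X \<inter> Z)"
      unfolding squarefree_iff_no_square_off_t[OF monic_poly_nonzero]
      using t_square_dvd_monic_poly_iff[of n] n(1) by (auto simp: X_def Z_def)
    then show ?thesis by (simp add: prob_squarefree_def random_monic_poly_conv vimage_def)
  qed
  also have "\<dots> = measure_pmf.prob (Pi_pmf {..<n} 0 \<mu>) X - measure_pmf.prob (Pi_pmf {..<n} 0 \<mu>) (X \<inter> Z)"
    by (rule measure_pmf.finite_measure_Diff) auto
  also have "measure_pmf.prob (Pi_pmf {..<n} 0 \<mu>) (X \<inter> Z) =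
             w * measure_pmf.prob (Pi_pmf {..<n} 0 \<nu>) X"
    using n(1) unfolding Z_def w_def \<nu>_def by (intro prob_Pi_pmf_two_zero) simp
  finally have "prob_squarefree \<mu> n = (\<kappa> + a) - w * (\<kappa> + b)"
    by (simp add: a_def b_def)
  moreover have "kappa \<mu> = \<kappa> * (1 - w)"
  proof -
    have "1 / (1 + 1 / q) = q / (q + 1)" using q by (simp add: field_simps)
    then show ?thesis by (simp add: kappa_def w_def q_def \<kappa>_def)
  qed
  ultimately have "prob_squarefree \<mu> n - kappa \<mu> = a - w * b" by (simp add: algebra_simps)
  then have "\<bar>prob_squarefree \<mu> n - kappa \<mu>\<bar> \<le> \<bar>a\<bar> + \<bar>w * b\<bar>" by simp
  also have "\<bar>w * b\<bar> \<le> 1 * \<bar>b\<bar>" unfolding abs_mult using w by (intro mult_right_mono) auto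
  also have "\<bar>a\<bar> \<le> sieve_error q c D n"
    unfolding a_def X_def \<kappa>_def q_def by (rule prob_no_square_off_t_approx[OF F c n])
  also have "\<bar>b\<bar> \<le> sieve_error q c D n"
    unfolding b_def X_def \<kappa>_def q_def
    by (rule prob_no_square_off_t_approx[OF _ c n]) (auto simp: \<nu>_def intro: F)
  finally show ?thesis by (simp add: q_def)
qed

text \<open>
  With \<open>D\<close> about \<open>n powr 0.3\<close>, the three parts of the error decay exponentially in
  \<open>n powr 0.3\<close>, \<open>n powr 0.7\<close> and \<open>n powr 0.3\<close>, all of larger order than \<open>n powr 0.25\<close>.
\<close>

definition sieve_level :: "nat \<Rightarrow> nat" where
  "sieve_level n = nat \<lceil>real n powr (3 / 10)\<rceil>"

lemma sieve_level_bounds: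
  "real n powr (3 / 10) \<le> real (sieve_level n)" "real (sieve_level n) \<le> real n powr (3 / 10) + 1"
proof -
  have "0 \<le> \<lceil>real n powr (3 / 10)\<rceil>"
    using powr_ge_zero[of "real n" "3 / 10"] by linarith
  then have "real (sieve_level n) = of_int \<lceil>real n powr (3 / 10)\<rceil>" by (simp add: sieve_level_def)
  then show "real n powr (3 / 10) \<le> real (sieve_level n)" "real (sieve_level n) \<le> real n powr (3 / 10) + 1"
    by linarith+
qed

lemma power_le_powr:
  assumes "0 < x" "x \<le> (1::real)" "y \<le> real k"
  shows "x ^ k \<le> x powr y"
  using assms by (simp add: powr_mono' flip: powr_realpow)

lemma sieve_error_eventually_le:
  fixes q c :: real
  assumes q: "2 \<le> q" and c: "0 < c" "c < 1"
  shows "eventually (\<lambda>n. 2 * sieve_error q c (sieve_level n) n \<le> q powr (- (real n powr (1 / 4)))) sequentially"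
proof -
  define \<rho> where "\<rho> = (1 + c) / 2"
  have \<rho>: "0 < \<rho>" "\<rho> < 1" using c by (auto simp: \<rho>_def)
  define r where "r = - ln \<rho>"
  define s where "s = - ln c"
  define b where "b = ln q"
  have pos: "r > 0" "s > 0" "b > 0" using \<rho> c q by (auto simp: r_def s_def b_def)
  have e1: "eventually (\<lambda>n. (real n + 1) * exp (- r * real n powr (3 / 10))
      \<le> exp (- b * real n powr (1 / 4)) / 8) sequentially"
    using pos by real_asymp
  have e2: "eventually (\<lambda>n. 2 * (exp (b * (2 * real n powr (3 / 10) + 3)) *
        exp (- s * ((real n - 2) / (4 * (real n powr (3 / 10) + 1)) - 1)))
      \<le> exp (- b * real n powr (1 / 4)) / 8) sequentially"
    using pos by real_asymp
  have e3: "eventually (\<lambda>n. 5 * exp (- b * real n powr (3 / 10))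
      \<le> exp (- b * real n powr (1 / 4)) / 8) sequentially"
    using pos by real_asymp
  show ?thesis using e1 e2 e3 eventually_ge_at_top[of 2]
  proof eventually_elim
    case (elim n)
    define D where "D = sieve_level n"
    note D = sieve_level_bounds[of n, folded D_def]
    define x where "x = real n powr (3 / 10)"
    have x: "x \<ge> 1" using elim(4) by (simp add: x_def ge_one_powr_ge_zero)
    then have D0: "D > 0" using D(1) by (cases D) (auto simp: x_def)
    have "\<rho> ^ D \<le> \<rho> powr x" using D \<rho> by (intro power_le_powr) (auto simp: x_def)
    also have "\<dots> = exp (- r * x)" using \<rho> by (simp add: powr_def r_def mult.commute)
    finally have "(real n + 1) * \<rho> ^ D \<le> (real n + 1) * exp (- r * x)"
      by (intro mult_left_mono) auto
    with elim(1) have A: "(real n + 1) * \<rho> ^ D \<le> exp (- b * real n powr (1 / 4)) / 8"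
      unfolding x_def by linarith
    have "q ^ (2 * D + 1) = q powr (real (2 * D + 1))" using q by (subst powr_realpow) auto
    also have "\<dots> \<le> q powr (2 * x + 3)" using q D by (intro powr_mono) (auto simp: x_def)
    also have "\<dots> = exp (b * (2 * x + 3))" using q by (simp add: powr_def b_def mult.commute)
    finally have Q: "q ^ (2 * D + 1) \<le> exp (b * (2 * x + 3))" .
    have "(real n - 2) / (4 * (x + 1)) - 1 \<le> (real n - 2) / (4 * real D) - 1"
      using D D0 elim(4) x by (intro diff_right_mono divide_left_mono) (auto simp: x_def)
    also have "\<dots> \<le> real ((n - 2) div (4 * D))"
    proof -
      have "n - 2 < 4 * D * ((n - 2) div (4 * D) + 1)"
        using D0 dividend_less_times_div[of "4 * D" "n - 2"] by simp
      then have "real (n - 2) < real (4 * D * ((n - 2) div (4 * D) + 1))" by (simp only: of_nat_less_iff)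
      then have "real n - 2 < (real ((n - 2) div (4 * D)) + 1) * (4 * real D)"
        using elim(4) by (simp add: of_nat_diff algebra_simps)
      then have "(real n - 2) / (4 * real D) < real ((n - 2) div (4 * D)) + 1"
        using D0 by (simp add: pos_divide_less_eq)
      then show ?thesis by simp
    qed
    finally have "c ^ ((n - 2) div (4 * D)) \<le> c powr ((real n - 2) / (4 * (x + 1)) - 1)"
      using c by (intro power_le_powr) auto
    also have "\<dots> = exp (- s * ((real n - 2) / (4 * (x + 1)) - 1))"
      using c by (simp add: powr_def s_def mult.commute)
    finally have "2 * (q ^ (2 * D + 1) * c ^ ((n - 2) div (4 * D))) \<le>
        2 * (exp (b * (2 * x + 3)) * exp (- s * ((real n - 2) / (4 * (x + 1)) - 1)))"
      using Q c q by (intro mult_left_mono mult_mono) auto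
    with elim(2) have B: "2 * (q ^ (2 * D + 1) * c ^ ((n - 2) div (4 * D))) \<le> exp (- b * real n powr (1 / 4)) / 8"
      unfolding x_def by linarith
    have "1 / q ^ D = (1 / q) ^ D" by (simp add: power_divide)
    also have "\<dots> \<le> (1 / q) powr x" using q D by (intro power_le_powr) (auto simp: x_def)
    also have "\<dots> = exp (- b * x)" using q by (simp add: powr_def b_def ln_div mult.commute)
    finally have "5 / q ^ D \<le> 5 * exp (- b * x)" by simp
    with elim(3) have C: "5 / q ^ D \<le> exp (- b * real n powr (1 / 4)) / 8" unfolding x_def by linarith
    have "sieve_error q c D n \<le> 3 * (exp (- b * real n powr (1 / 4)) / 8)"
      using A B C by (simp add: sieve_error_def \<rho>_def mult.assoc)
    moreover have "q powr (- (real n powr (1 / 4))) = exp (- b * real n powr (1 / 4))"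
      using q by (simp add: powr_def b_def mult.commute)
    moreover have "0 \<le> exp (- b * real n powr (1 / 4))" by simp
    ultimately show ?case unfolding D_def by linarith
  qed
qed

lemma eventually_mult_sieve_level_less:
  "eventually (\<lambda>n. p * sieve_level n + 1 < n) sequentially"
proof -
  have "eventually (\<lambda>n. real p * (real n powr (3 / 10) + 1) + 1 < real n) sequentially"
    by real_asymp
  then show ?thesis
  proof eventually_elim
    case (elim n)
    have "real p * real (sieve_level n) \<le> real p * (real n powr (3 / 10) + 1)"
      using sieve_level_bounds(2) by (intro mult_left_mono) auto
    with elim have "real (p * sieve_level n + 1) < real n" by simp
    then show ?case by (simp only: of_nat_less_iff)
  qed
qed

theorem theorem1p2:
  shows "(\<exists>C::real. \<forall>c::real. c < 1 \<longrightarrow>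
           (\<forall>\<^sub>F n in sequentially. \<forall>\<mu> :: nat \<Rightarrow> 'a::finite_field pmf.
              (MAX i\<in>{..<n}. MAX \<alpha>\<in>UNIV - {0}. cmod (fourier (\<mu> i) \<alpha>)) \<le> c \<longrightarrow>
              \<bar>prob_squarefree \<mu> n - kappa \<mu>\<bar>
                \<le> C * real CARD('a) powr (- (real n powr (1 / 4))))) \<and>
         (\<forall>(\<mu> :: nat \<Rightarrow> 'a pmf) n. n \<ge> 2 \<longrightarrow>
            Lambda \<mu> n = pmf (\<mu> 0) 0 * pmf (\<mu> 1) 0 \<and>
            kappa \<mu> = c0 TYPE('a) * (1 - Lambda \<mu> n))"
proof (intro conjI exI[of _ 1] allI impI)
  fix c :: real assume "c < 1"
  \<comment> \<open>A positive bound is needed for taking its logarithm.\<close>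
  define c' where "c' = max c (1 / 2)"
  have c': "0 < c'" "c' < 1" "c \<le> c'" using \<open>c < 1\<close> by (auto simp: c'_def)
  show "\<forall>\<^sub>F n in sequentially. \<forall>\<mu> :: nat \<Rightarrow> 'a::finite_field pmf.
              (MAX i\<in>{..<n}. MAX \<alpha>\<in>UNIV - {0}. cmod (fourier (\<mu> i) \<alpha>)) \<le> c \<longrightarrow>
              \<bar>prob_squarefree \<mu> n - kappa \<mu>\<bar> \<le> 1 * real CARD('a) powr (- (real n powr (1 / 4)))"
    using sieve_error_eventually_le[OF card_field_ge_2[where 'a = 'a] c'(1,2)]
      eventually_mult_sieve_level_less[of "CHAR('a)"] eventually_gt_at_top[of 2]
  proof eventually_elim
    case (elim n)
    show ?case
    proof (intro allI impI)
      fix \<mu> :: "nat \<Rightarrow> 'a pmf"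
      assume max: "(MAX i\<in>{..<n}. MAX \<alpha>\<in>UNIV - {0}. cmod (fourier (\<mu> i) \<alpha>)) \<le> c"
      have F: "cmod (fourier (\<mu> i) \<alpha>) \<le> c'" if "i < n" "\<alpha> \<noteq> 0" for i \<alpha>
      proof -
        have "cmod (fourier (\<mu> i) \<alpha>) \<le> (MAX \<alpha>\<in>UNIV - {0}. cmod (fourier (\<mu> i) \<alpha>))"
          using that by (intro Max_ge) auto
        also have "\<dots> \<le> (MAX i\<in>{..<n}. MAX \<alpha>\<in>UNIV - {0}. cmod (fourier (\<mu> i) \<alpha>))"
          using that by (intro Max_ge) auto
        finally show ?thesis using max c'(3) by linarith
      qed
      have "\<bar>prob_squarefree \<mu> n - kappa \<mu>\<bar> \<le> 2 * sieve_error (real CARD('a)) c' (sieve_level n) n"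
        by (rule prob_squarefree_approx) (use F c' elim in auto)
      with elim(1) show "\<bar>prob_squarefree \<mu> n - kappa \<mu>\<bar> \<le> 1 * real CARD('a) powr (- (real n powr (1 / 4)))"
        by linarith
    qed
  qed
next
  fix \<mu> :: "nat \<Rightarrow> 'a pmf" and n :: nat assume "n \<ge> 2"
  then show "Lambda \<mu> n = pmf (\<mu> 0) 0 * pmf (\<mu> 1) 0" by (rule Lambda_eq)
  then show "kappa \<mu> = c0 TYPE('a) * (1 - Lambda \<mu> n)" by (simp add: kappa_def c0_def)
qed

end
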